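(* Let $\mathbf{X}=(X_t)_{t\ge 0}$ be a spectrally positive Lévy process of unbounded variation with Laplace exponent $\varphi$. Suppose that $\varphi''\in \mathrm{WLSC}(\alpha-2,c,x_0)$ for some $c\in(0,1]$, $x_0\ge 0$ and $\alpha>0$. Then the probability distribution of $X_t$ is absolutely continuous for all $t>0$. If we denote its density by $p(t,\cdot)$, then for each $\epsilon>0$ there is $M_0>0$ such that $$\Big| p\big(t,-t\varphi'(w)\big)\sqrt{2\pi t\varphi''(w)}\,\exp\big\{t\big(w\varphi'(w)-\varphi(w)\big)\big\}-1\Big|\le \epsilon,$$ provided that $w>x_0$, $t>0$ and $tw^2\varphi''(w)>M_0$.
   Context: A spectrally positive Lévy process is a Lévy process on $\mathbb{R}$ with only positive jumps. There are $\sigma\ge 0$, $b\in\mathbb{R}$ and a $\sigma$-finite measure $\nu$ on $(0,\infty)$ with $\int_{(0,\infty)}(1\wedge x^2)\,\nu(dx)<\infty$ such that the Laplace exponent $\varphi$, defined by $\mathbb{E}e^{-\lambda X_t}=e^{t\varphi(\lambda)}$ for $\lambda\ge0$, equals $$\varphi(\lambda)=\sigma^2\lambda^2-b\lambda+\int_{(0,\infty)}\big(e^{-\lambda x}-1+\lambda x\mathbf{1}_{x<1}\big)\,\nu(dx).$$ Unbounded variation means that $\sigma>0$ or $\int_{(0,1)}x\,\nu(dx)=\infty$. Scaling: for $\alpha\in\mathbb{R}$, $c\in(0,1]$, $x_1\ge0$, a nonnegative function $f$ belongs to $\mathrm{WLSC}(\alpha,c,x_1)$ if $f(\lambda x)\ge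 c\lambda^{\alpha}f(x)$ for all $\lambda\ge1$ and $x>x_1$. $p(t,\cdot)$ denotes the continuous version of the density of $X_t$. *)

theory Defs
  imports "HOL-Probability.Probability"
begin

text \<open>
  Time is the half-line \<open>[0, \<infinity>)\<close>; a process is a family \<open>X :: real \<Rightarrow> 'a \<Rightarrow> real\<close> of which only the
  members \<open>X t\<close> with \<open>t \<ge> 0\<close> matter.
\<close>

definition levy_process :: "'a measure \<Rightarrow> (real \<Rightarrow> 'a \<Rightarrow> real) \<Rightarrow> bool" where
  "levy_process M X \<longleftrightarrow>
     prob_space M \<and>
     (\<forall>t\<ge>0. X t \<in> borel_measurable M) \<and>
     (AE \<omega> in M. X 0 \<omega> = 0) \<and>
     (\<forall>(s :: nat \<Rightarrow> real) n. 0 \<le> s 0 \<and> mono s \<longrightarrow>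
        prob_space.indep_vars M (\<lambda>_. borel) (\<lambda>k \<omega>. X (s (Suc k)) \<omega> - X (s k) \<omega>) {..<n}) \<and>
     (\<forall>s\<ge>0. \<forall>t\<ge>0. distr M borel (\<lambda>\<omega>. X (s + t) \<omega> - X s \<omega>) = distr M borel (X t)) \<and>
     (AE \<omega> in M.
        (\<forall>t\<ge>0. ((\<lambda>s. X s \<omega>) \<longlongrightarrow> X t \<omega>) (at_right t)) \<and>
        (\<forall>t>0. \<exists>l. ((\<lambda>s. X s \<omega>) \<longlongrightarrow> l) (at_left t)))"

text \<open>
  ``Only positive jumps'' excludes negative jumps; processes without jumps, such as Brownian motion
  with drift, are included.
\<close>

definition spectrally_positive_levy_process ::
  "'a measure \<Rightarrow> (real \<Rightarrow> 'a \<Rightarrow> real) \<Rightarrow> bool" where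
  "spectrally_positive_levy_process M X \<longleftrightarrow>
     levy_process M X \<and>
     (AE \<omega> in M. \<forall>t>0. \<forall>l. ((\<lambda>s. X s \<omega>) \<longlongrightarrow> l) (at_left t) \<longrightarrow> l \<le> X t \<omega>)"

text \<open>
  Only the values \<open>\<phi> u\<close> with \<open>u \<ge> 0\<close> are determined by the process.
\<close>

definition laplace_exponent ::
  "'a measure \<Rightarrow> (real \<Rightarrow> 'a \<Rightarrow> real) \<Rightarrow> (real \<Rightarrow> real) \<Rightarrow> bool" where
  "laplace_exponent M X \<phi> \<longleftrightarrow>
     (\<forall>t\<ge>0. \<forall>u\<ge>0. has_bochner_integral M (\<lambda>\<omega>. exp (- u * X t \<omega>)) (exp (t * \<phi> u)))"

definition levy_measure_pos :: "real measure \<Rightarrow> bool" where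
  "levy_measure_pos \<nu> \<longleftrightarrow>
     sets \<nu> = sets (restrict_space borel {0<..}) \<and>
     sigma_finite_measure \<nu> \<and>
     (\<integral>\<^sup>+x. ennreal (min 1 (x\<^sup>2)) \<partial>\<nu>) < \<infinity>"

text \<open>
  The Gaussian term is \<open>\<sigma>\<^sup>2u\<^sup>2\<close>, without the factor \<open>1/2\<close>.
\<close>

definition levy_khintchine ::
  "(real \<Rightarrow> real) \<Rightarrow> real \<Rightarrow> real \<Rightarrow> real measure \<Rightarrow> bool" where
  "levy_khintchine \<phi> \<sigma> b \<nu> \<longleftrightarrow>
     0 \<le> \<sigma> \<and> levy_measure_pos \<nu> \<and>
     (\<forall>u\<ge>0. \<phi> u = \<sigma>\<^sup>2 * u\<^sup>2 - b * u
        + (\<integral>x. (exp (- u * x) - 1 + u * x * indicator {..<1} x) \<partial>\<nu>))"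

definition unbounded_variation :: "real \<Rightarrow> real measure \<Rightarrow> bool" where
  "unbounded_variation \<sigma> \<nu> \<longleftrightarrow> 0 < \<sigma> \<or> (\<integral>\<^sup>+x\<in>{0<..<1}. ennreal x \<partial>\<nu>) = \<infinity>"

text \<open>
  The weak lower scaling condition for a function on \<open>(0, \<infinity>)\<close>; values at other arguments are ignored.
\<close>

definition WLSC :: "real \<Rightarrow> real \<Rightarrow> real \<Rightarrow> (real \<Rightarrow> real) set" where
  "WLSC \<alpha> c x1 =
     {f. (\<forall>x>0. 0 \<le> f x) \<and> (\<forall>r\<ge>1. \<forall>x>x1. c * r powr \<alpha> * f x \<le> f (r * x))}"

text \<open>
  Two continuous functions that are densities of the same random variable agree everywhere, so
  this determines \<open>p\<close> uniquely.
\<close>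

definition continuous_density :: "'a measure \<Rightarrow> ('a \<Rightarrow> real) \<Rightarrow> (real \<Rightarrow> real) \<Rightarrow> bool" where
  "continuous_density M Y p \<longleftrightarrow>
     continuous_on UNIV p \<and> (\<forall>x. 0 \<le> p x) \<and> distributed M lborel Y (\<lambda>x. ennreal (p x))"

end

theory Submission
  imports Defs "HOL-Complex_Analysis.Complex_Analysis" "HOL-Real_Asymp.Real_Asymp"
begin

text \<open>
  The proof is the saddle point method. Continuing the identity \<open>E exp (- u X t) = exp (t \<phi> u)\<close>
  analytically to \<open>Re u > 0\<close>, with \<open>\<Phi>\<close> the holomorphic extension of \<open>\<phi>\<close> given by the
  Levy--Khintchine formula, shows that the law of \<open>X t\<close> tilted by \<open>exp (- w x - t \<phi> w)\<close> has the
  characteristic function \<open>\<xi> \<mapsto> exp (t (\<Phi> (w - i \<xi>) - \<phi> w))\<close>. If this function is integrable, then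
  Fourier inversion gives the tilted law, and hence \<open>X t\<close>, a continuous density. At the point
  \<open>x = - t \<phi>' w\<close>, which is the mean of the tilted law, the substitution \<open>\<xi> = u / s\<close> with
  \<open>s = sqrt (t \<phi>'' w)\<close>, the standard deviation of the tilted law, turns the normalised density of the
  theorem into \<open>1 / sqrt (2 \<pi>)\<close> times the real part of the integral of \<open>exp (E u)\<close>, where
  \<open>E u = t (\<Phi> (w - i u / s) - \<phi> w + i (u / s) \<phi>' w)\<close>. This is compared with the integral of
  \<open>exp (- u\<^sup>2 / 2)\<close>.

  Two estimates carry the comparison; both depend on \<open>t\<close> and \<open>w\<close> only through
  \<open>T = t w\<^sup>2 \<phi>'' w = (w s)\<^sup>2\<close>.

  The first is a lower bound for \<open>- Re (E u)\<close> by a multiple of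
  \<open>u\<^sup>2 (1 + A \<bar>u\<bar> / sqrt T) powr (\<alpha> - 2)\<close> (\<open>Re_complex_exponent_scaling_decay\<close>). Up to the Gaussian
  term, the real part of \<open>\<phi> w - \<Phi> (w - i \<xi>)\<close> is the \<open>\<nu>\<close>-integral of \<open>exp (- w x) (1 - cos (\<xi> x))\<close>, which
  dominates a multiple of \<open>\<xi>\<^sup>2\<close> times the integral of \<open>x\<^sup>2 exp (- w x)\<close> over \<open>x \<le> 1 / \<bar>\<xi>\<bar>\<close>. Take
  \<open>L = w + A \<bar>\<xi>\<bar>\<close>. The scaling condition says that \<open>\<phi>''\<close> keeps a fixed fraction of its size from \<open>L\<close> to
  \<open>2 L\<close>, whereas in this step the contribution of the jumps larger than \<open>A / L\<close> shrinks by the factor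
  \<open>exp (- A)\<close>. For large \<open>A\<close> the Gaussian term and the jumps up to \<open>A / L \<le> 1 / \<bar>\<xi>\<bar>\<close> therefore carry a
  fixed fraction of \<open>\<phi>'' L\<close>, and the scaling condition compares \<open>\<phi>'' L\<close> with \<open>\<phi>'' w\<close>. One may assume
  \<open>\<alpha> \<le> 2\<close>; then for \<open>T \<ge> 1\<close> the bound yields one integrable majorant for all \<open>exp (E u)\<close>.

  The second is \<open>\<bar>E u + u\<^sup>2 / 2\<bar> \<le> D \<bar>u\<bar>\<^sup>3 / (3 sqrt T)\<close>. It is Taylor's formula
  (\<open>complex_exponent_gaussian_approx\<close>), where the third moment of the tilted measure
  \<open>exp (- w x) \<nu>(dx)\<close> is bounded by a multiple of \<open>\<phi>'' (w / 2) / w\<close> and then, by \<open>deriv_deriv_exponent_doubling\<close>, of \<open>\<phi>'' w / w\<close>.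

  Dominated convergence as \<open>T \<rightarrow> \<infinity>\<close> (\<open>integral_near_gaussian\<close>) finishes the proof. The density is
  written with the one tilt \<open>w = x0 + 1\<close>; since a continuous density is unique,
  every \<open>w > x0\<close> gives the same function.
\<close>

section \<open>Fourier inversion for integrable characteristic functions\<close>

text \<open>
  For the characteristic function of a real law the inverse Fourier transform is real-valued, so taking the
  real part loses nothing; it makes the density a function into the reals.
\<close>

definition inverse_fourier :: "(real \<Rightarrow> complex) \<Rightarrow> real \<Rightarrow> real" where
  "inverse_fourier \<psi> x = Re (\<integral>\<xi>. iexp (- (\<xi> * x)) * \<psi> \<xi> \<partial>lborel) / (2 * pi)"

lemma continuous_on_inverse_fourier:
  assumes "integrable lborel \<psi>"
  shows "continuous_on UNIV (inverse_fourier \<psi>)"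
proof -
  from assms have [measurable]: "\<psi> \<in> borel_measurable borel" by auto
  have "isCont (\<lambda>x. \<integral>\<xi>. iexp (- (\<xi> * x)) * \<psi> \<xi> \<partial>lborel) y" for y
    unfolding continuous_at_sequentially comp_def
  proof safe
    fix X assume X: "X \<longlonglongrightarrow> y"
    show "(\<lambda>n. \<integral>\<xi>. iexp (- (\<xi> * X n)) * \<psi> \<xi> \<partial>lborel) \<longlonglongrightarrow> (\<integral>\<xi>. iexp (- (\<xi> * y)) * \<psi> \<xi> \<partial>lborel)"
      by (rule integral_dominated_convergence[where w="\<lambda>\<xi>. norm (\<psi> \<xi>)"])
        (use assms in \<open>auto intro!: tendsto_intros X simp: norm_mult\<close>)
  qed
  then show ?thesis
    unfolding inverse_fourier_def
    by (intro continuous_at_imp_continuous_on ballI continuous_intros) auto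
qed

lemma abs_inverse_fourier_le:
  assumes "integrable lborel \<psi>"
  shows "\<bar>inverse_fourier \<psi> x\<bar> \<le> (\<integral>\<xi>. norm (\<psi> \<xi>) \<partial>lborel) / (2 * pi)"
proof -
  have "\<bar>Re (\<integral>\<xi>. iexp (- (\<xi> * x)) * \<psi> \<xi> \<partial>lborel)\<bar> \<le> norm (\<integral>\<xi>. iexp (- (\<xi> * x)) * \<psi> \<xi> \<partial>lborel)"
    by (rule abs_Re_le_cmod)
  also have "\<dots> \<le> (\<integral>\<xi>. norm (iexp (- (\<xi> * x)) * \<psi> \<xi>) \<partial>lborel)"
    by (rule integral_norm_bound)
  also have "\<dots> = (\<integral>\<xi>. norm (\<psi> \<xi>) \<partial>lborel)"
    by (simp add: norm_mult)
  finally show ?thesis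
    unfolding inverse_fourier_def by (simp add: divide_right_mono)
qed

text \<open>
  The kernel of Levy's inversion formula is itself an integral of exponentials over \<open>[a, b]\<close>. This is what
  turns the inversion formula into a statement about a density.
\<close>

lemma integral_iexp_atLeastAtMost:
  assumes "a \<le> b" "\<xi> \<noteq> 0"
  shows "(\<integral>x. indicator {a..b} x *\<^sub>R iexp (- (\<xi> * x)) \<partial>lborel)
    = (iexp (- (\<xi> * a)) - iexp (- (\<xi> * b))) / (\<i> * \<xi>)"
proof -
  have "((\<lambda>x. iexp (- (\<xi> * x)) / (- \<i> * \<xi>)) has_vector_derivative iexp (- (\<xi> * x))) (at x within {a..b})" for x
  proof -
    have "((\<lambda>z. exp (\<i> * (- (\<xi> * z))) / (- \<i> * \<xi>)) has_field_derivative iexp (- (\<xi> * x))) (at (of_real x))"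
      using assms by (auto intro!: derivative_eq_intros simp: mult.left_commute[of \<i> _ \<i>])
    from has_vector_derivative_real_field[OF this] show ?thesis
      by simp
  qed
  from integral_FTC_atLeastAtMost[OF assms(1) this]
  have "(\<integral>x. indicator {a..b} x *\<^sub>R iexp (- (\<xi> * x)) \<partial>lborel)
    = iexp (- (\<xi> * b)) / (- \<i> * \<xi>) - iexp (- (\<xi> * a)) / (- \<i> * \<xi>)"
    by (simp add: continuous_intros)
  then show ?thesis using assms by (simp add: field_simps)
qed

context real_distribution
begin

text \<open>
  In Levy's inversion formula integrability of the characteristic function allows the limit of the truncated
  integrals to be taken inside, and then Fubini's theorem applies to the kernel written as an integral.
\<close>

lemma measure_Ioc_eq_integral_inverse_fourier_if_no_atoms:
  assumes int: "integrable lborel (char M)" and ab: "a \<le> b"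
    and atoms: "measure M {a} = 0" "measure M {b} = 0"
  shows "measure M {a<..b} = (\<integral>x. indicator {a..b} x * inverse_fourier (char M) x \<partial>lborel)"
proof -
  let ?\<psi> = "char M"
  let ?F = "\<lambda>\<xi>. (iexp (- (\<xi> * a)) - iexp (- (\<xi> * b))) / (\<i> * \<xi>) * ?\<psi> \<xi>"
  have AE0: "AE \<xi> in lborel. \<xi> \<noteq> (0::real)"
    by (rule AE_lborel_singleton)
  have bound: "norm (?F \<xi>) \<le> (b - a) * norm (?\<psi> \<xi>)" for \<xi>
  proof (cases "\<xi> = 0")
    case False
    then show ?thesis
      using Levy_Inversion_aux2[of "-b" "-a" \<xi>] ab
      unfolding norm_mult[of _ "?\<psi> \<xi>"] by (intro mult_right_mono) auto
  qed (use ab in auto)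
  have "(\<lambda>T::nat. CLBINT \<xi>=ereal (- real T)..ereal (real T). ?F \<xi>) \<longlonglongrightarrow> (\<integral>\<xi>. ?F \<xi> \<partial>lborel)"
  proof -
    have "(\<lambda>T::nat. \<integral>\<xi>. indicator {-real T<..<real T} \<xi> *\<^sub>R ?F \<xi> \<partial>lborel) \<longlonglongrightarrow> (\<integral>\<xi>. ?F \<xi> \<partial>lborel)"
    proof (rule integral_dominated_convergence[where w="\<lambda>\<xi>. (b - a) * norm (?\<psi> \<xi>)"])
      show "AE \<xi> in lborel. (\<lambda>T::nat. indicator {-real T<..<real T} \<xi> *\<^sub>R ?F \<xi>) \<longlonglongrightarrow> ?F \<xi>"
      proof (rule AE_I2)
        fix \<xi> :: real
        obtain N :: nat where "\<bar>\<xi>\<bar> < N" using reals_Archimedean2 by blast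
        then have "eventually (\<lambda>T::nat. indicator {-real T<..<real T} \<xi> *\<^sub>R ?F \<xi> = ?F \<xi>) sequentially"
          by (intro eventually_sequentiallyI[of N]) (auto simp: indicator_def)
        then show "(\<lambda>T::nat. indicator {-real T<..<real T} \<xi> *\<^sub>R ?F \<xi>) \<longlonglongrightarrow> ?F \<xi>"
          by (rule tendsto_eventually)
      qed
      show "AE \<xi> in lborel. norm (indicator {-real T<..<real T} \<xi> *\<^sub>R ?F \<xi>) \<le> (b - a) * norm (?\<psi> \<xi>)" for T :: nat
        using bound ab by (auto simp: indicator_def)
    qed (use int in auto)
    then show ?thesis
      by (simp add: interval_lebesgue_integral_def set_lebesgue_integral_def einterval_eq_Icc)
  qed
  then have "(\<lambda>T::nat. 1 / (2 * pi) * (CLBINT \<xi>=ereal (- real T)..ereal (real T). ?F \<xi>)) \<longlonglongrightarrow> 1 / (2 * pi) * (\<integral>\<xi>. ?F \<xi> \<partial>lborel)"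
    by (intro tendsto_intros)
  moreover have "(\<lambda>T::nat. 1 / (2 * pi) * (CLBINT \<xi>=ereal (- real T)..ereal (real T). ?F \<xi>))
      \<longlonglongrightarrow> complex_of_real (measure M {a<..b})"
    using Levy_Inversion[OF ab atoms] by simp
  ultimately have *: "1 / (2 * pi) * (\<integral>\<xi>. ?F \<xi> \<partial>lborel) = complex_of_real (measure M {a<..b})"
    by (rule LIMSEQ_unique)
  have "(\<integral>\<xi>. ?F \<xi> \<partial>lborel)
      = (\<integral>\<xi>. (\<integral>x. indicator {a..b} x *\<^sub>R (iexp (- (\<xi> * x)) * ?\<psi> \<xi>) \<partial>lborel) \<partial>lborel)"
  proof (rule integral_cong_AE)
    show "AE \<xi> in lborel. ?F \<xi> = (\<integral>x. indicator {a..b} x *\<^sub>R (iexp (- (\<xi> * x)) * ?\<psi> \<xi>) \<partial>lborel)"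
      using AE0
    proof eventually_elim
      fix \<xi> :: real assume "\<xi> \<noteq> 0"
      have "(\<integral>x. indicator {a..b} x *\<^sub>R (iexp (- (\<xi> * x)) * ?\<psi> \<xi>) \<partial>lborel)
          = (\<integral>x. (indicator {a..b} x *\<^sub>R iexp (- (\<xi> * x))) * ?\<psi> \<xi> \<partial>lborel)"
        by simp
      also have "\<dots> = (\<integral>x. indicator {a..b} x *\<^sub>R iexp (- (\<xi> * x)) \<partial>lborel) * ?\<psi> \<xi>"
        by (rule integral_mult_left_zero)
      also have "\<dots> = ?F \<xi>"
        using integral_iexp_atLeastAtMost[OF ab \<open>\<xi> \<noteq> 0\<close>] by simp
      finally show "?F \<xi> = (\<integral>x. indicator {a..b} x *\<^sub>R (iexp (- (\<xi> * x)) * ?\<psi> \<xi>) \<partial>lborel)" by simp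
    qed
  qed measurable
  also have "\<dots> = (\<integral>x. (\<integral>\<xi>. indicator {a..b} x *\<^sub>R (iexp (- (\<xi> * x)) * ?\<psi> \<xi>) \<partial>lborel) \<partial>lborel)"
  proof (rule lborel_pair.Fubini_integral)
    have "integrable (lborel \<Otimes>\<^sub>M lborel) (\<lambda>(x, \<xi>). indicator {a..b} x *\<^sub>R ?\<psi> \<xi>)"
    proof (rule lborel_pair.Fubini_integrable)
      show "integrable lborel (\<lambda>x. \<integral>\<xi>. norm (case (x, \<xi>) of (x, \<xi>) \<Rightarrow> indicator {a..b} x *\<^sub>R ?\<psi> \<xi>) \<partial>lborel)"
        by (simp add: emeasure_lborel_Icc_eq)
    qed (use int in auto)
    then show "integrable (lborel \<Otimes>\<^sub>M lborel)
        (\<lambda>(x, \<xi>). indicator {a..b} x *\<^sub>R (iexp (- (\<xi> * x)) * ?\<psi> \<xi>))"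
      by (rule Bochner_Integration.integrable_bound) (auto simp: norm_mult)
  qed
  also have "\<dots> = (\<integral>x. indicator {a..b} x *\<^sub>R (\<integral>\<xi>. iexp (- (\<xi> * x)) * ?\<psi> \<xi> \<partial>lborel) \<partial>lborel)"
    by simp
  finally have "Re (\<integral>\<xi>. ?F \<xi> \<partial>lborel)
      = Re (\<integral>x. indicator {a..b} x *\<^sub>R (\<integral>\<xi>. iexp (- (\<xi> * x)) * ?\<psi> \<xi> \<partial>lborel) \<partial>lborel)"
    by simp
  also have "\<dots> = (\<integral>x. Re (indicator {a..b} x *\<^sub>R (\<integral>\<xi>. iexp (- (\<xi> * x)) * ?\<psi> \<xi> \<partial>lborel)) \<partial>lborel)"
  proof (rule integral_Re[symmetric])
    have "integrable lborel (\<lambda>x. indicator {a..b} x *\<^sub>R (\<integral>\<xi>. norm (?\<psi> \<xi>) \<partial>lborel))"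
      by (simp add: emeasure_lborel_Icc_eq)
    then show "integrable lborel (\<lambda>x. indicator {a..b} x *\<^sub>R (\<integral>\<xi>. iexp (- (\<xi> * x)) * ?\<psi> \<xi> \<partial>lborel))"
    proof (rule Bochner_Integration.integrable_bound)
      have "norm (\<integral>\<xi>. iexp (- (\<xi> * x)) * ?\<psi> \<xi> \<partial>lborel) \<le> (\<integral>\<xi>. norm (iexp (- (\<xi> * x)) * ?\<psi> \<xi>) \<partial>lborel)" for x
        by (rule integral_norm_bound)
      then show "AE x in lborel. norm (indicator {a..b} x *\<^sub>R (\<integral>\<xi>. iexp (- (\<xi> * x)) * ?\<psi> \<xi> \<partial>lborel))
          \<le> norm (indicator {a..b} x *\<^sub>R (\<integral>\<xi>. norm (?\<psi> \<xi>) \<partial>lborel))"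
        by (intro AE_I2) (auto simp: norm_mult indicator_def)
    qed measurable
  qed
  also have "\<dots> = (\<integral>x. 2 * pi * (indicator {a..b} x * inverse_fourier ?\<psi> x) \<partial>lborel)"
    by (intro Bochner_Integration.integral_cong) (auto simp: inverse_fourier_def indicator_def)
  finally have "Re (\<integral>\<xi>. ?F \<xi> \<partial>lborel) = 2 * pi * (\<integral>x. indicator {a..b} x * inverse_fourier ?\<psi> x \<partial>lborel)"
    by simp
  with arg_cong[OF *, of Re] show ?thesis
    by (simp del: of_real_mult add: Re_divide_of_real)
qed

text \<open>
  The inversion formula bounds the mass of a small interval, with endpoints off the countable set of atoms,
  by a constant times its length. Hence there are no atoms, and the inversion formula holds for all endpoints.
\<close>

lemma measure_singleton_eq_0_if_integrable_char:
  assumes int: "integrable lborel (char M)"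
  shows "measure M {x} = 0"
proof -
  define C where "C = (\<integral>\<xi>. norm (char M \<xi>) \<partial>lborel) / (2 * pi)"
  have C: "0 \<le> C" unfolding C_def by simp
  have "measure M {x} \<le> 2 * e * C" if e: "e > 0" for e
  proof -
    \<comment> \<open>A measure has only countably many atoms, so endpoints that are not atoms exist on both sides of \<open>x\<close>.\<close>
    have "\<exists>a\<in>{x-e<..<x}. a \<notin> {x. measure M {x} > 0}" "\<exists>b\<in>{x<..<x+e}. b \<notin> {x. measure M {x} > 0}"
      using e by (intro real_interval_avoid_countable_set countable_atoms; simp)+
    then obtain a b where ab: "x - e < a" "a < x" "x < b" "b < x + e"
        "measure M {a} = 0" "measure M {b} = 0"
      by (auto simp: not_less measure_le_0_iff)
    have "measure M {x} \<le> measure M {a<..b}"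
      using ab by (intro finite_measure_mono) auto
    also have "\<dots> = (\<integral>x. indicator {a..b} x * inverse_fourier (char M) x \<partial>lborel)"
      using ab int by (intro measure_Ioc_eq_integral_inverse_fourier_if_no_atoms) auto
    also have "\<dots> \<le> (\<integral>x. indicator {a..b} x * C \<partial>lborel)"
    proof (rule integral_mono)
      show "integrable lborel (\<lambda>x. indicator {a..b} x * C)"
        by (simp add: emeasure_lborel_Icc_eq)
      have "set_integrable lborel {a..b} (inverse_fourier (char M))"
        by (rule borel_integrable_atLeastAtMost')
          (rule continuous_on_subset[OF continuous_on_inverse_fourier[OF int]], simp)
      then show "integrable lborel (\<lambda>x. indicator {a..b} x * inverse_fourier (char M) x)"
        by (simp add: set_integrable_def)
      show "indicator {a..b} x * inverse_fourier (char M) x \<le> indicator {a..b} x * C" for x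
        using abs_inverse_fourier_le[OF int, of x] by (auto simp: C_def indicator_def)
    qed
    also have "\<dots> = (b - a) * C" using ab by simp
    also have "\<dots> \<le> 2 * e * C" using ab C by (intro mult_right_mono) auto
    finally show ?thesis .
  qed
  then have "((\<lambda>e. 2 * e * C) \<longlongrightarrow> 2 * 0 * C) (at_right 0) \<Longrightarrow> measure M {x} \<le> 2 * 0 * C"
    by (intro tendsto_lowerbound[of "\<lambda>e. 2 * e * C" _ "at_right 0"])
       (auto simp: eventually_at_filter)
  moreover have "((\<lambda>e. 2 * e * C) \<longlongrightarrow> 2 * 0 * C) (at_right 0)"
    by (intro tendsto_intros)
  ultimately show ?thesis by (simp add: measure_le_0_iff)
qed

lemma measure_Ioc_eq_integral_inverse_fourier:
  assumes "integrable lborel (char M)" "a \<le> b"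
  shows "measure M {a<..b} = (\<integral>x. indicator {a..b} x * inverse_fourier (char M) x \<partial>lborel)"
  using assms by (intro measure_Ioc_eq_integral_inverse_fourier_if_no_atoms measure_singleton_eq_0_if_integrable_char)

text \<open>
  If the density were negative at a point, then by continuity its integral over a short interval to the right
  of that point would be negative; but this integral is a probability.
\<close>

lemma inverse_fourier_char_nonneg:
  assumes int: "integrable lborel (char M)"
  shows "0 \<le> inverse_fourier (char M) x"
proof (rule ccontr)
  let ?q = "inverse_fourier (char M)"
  have cont: "continuous_on S ?q" for S
    using continuous_on_inverse_fourier[OF int] continuous_on_subset by blast
  have qint: "set_integrable lborel {a..b} ?q" for a b
    by (rule borel_integrable_atLeastAtMost'[OF cont])
  assume "\<not> 0 \<le> ?q x"
  then have neg: "?q x < 0" by simp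
  have mono: "0 \<le> integral {x..y} ?q" if "x \<le> y" for y
  proof -
    have "integral {x..y} ?q = (\<integral>z. indicator {x..y} z * ?q z \<partial>lborel)"
      using set_borel_integral_eq_integral(2)[OF qint] by (simp add: set_lebesgue_integral_def)
    then show ?thesis
      using measure_Ioc_eq_integral_inverse_fourier[OF int that] by (metis measure_nonneg)
  qed
  have "((\<lambda>y. integral {x..y} ?q) has_real_derivative ?q x) (at x within {x..x+1})"
    by (rule integral_has_real_derivative[OF cont]) simp
  from has_real_derivative_neg_dec_right[OF this neg]
  obtain d where d: "d > 0" "\<And>h. 0 < h \<Longrightarrow> x + h \<in> {x..x+1} \<Longrightarrow> h < d \<Longrightarrow> integral {x..x+h} ?q < integral {x..x} ?q"
    by auto
  have "0 < min 1 (d/2)" "min 1 (d/2) < d" "min 1 (d/2) \<le> 1" using d(1) by (auto simp: min_def)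
  with d(2)[of "min 1 (d/2)"] mono[of "x + min 1 (d/2)"] show False by auto
qed

theorem density_inverse_fourier_char:
  assumes int: "integrable lborel (char M)"
  shows "M = density lborel (\<lambda>x. ennreal (inverse_fourier (char M) x))"
proof (rule measure_eqI_lessThan)
  let ?q = "inverse_fourier (char M)" and ?N = "density lborel (\<lambda>x. ennreal (inverse_fourier (char M) x))"
  have cont: "continuous_on S ?q" for S
    using continuous_on_inverse_fourier[OF int] continuous_on_subset by blast
  have [measurable]: "?q \<in> borel_measurable borel"
    by (rule borel_measurable_continuous_onI[OF cont])
  fix x :: real
  show "emeasure M {x<..} < \<infinity>"
    by (simp add: less_top[symmetric])
  have eq: "emeasure M {x<..x + n} = emeasure ?N {x<..x + n}" for n :: nat
  proof -
    have "emeasure ?N {x<..x + n} = (\<integral>\<^sup>+y. ennreal (?q y) * indicator {x<..x+n} y \<partial>lborel)"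
      by (simp add: emeasure_density)
    also have "\<dots> = (\<integral>\<^sup>+y. ennreal (indicator {x..x+n} y * ?q y) \<partial>lborel)"
      by (intro nn_integral_cong_AE) (use AE_lborel_singleton[of x] in \<open>auto elim!: eventually_mono split: split_indicator\<close>)
    also have "\<dots> = ennreal (\<integral>y. indicator {x..x+n} y * ?q y \<partial>lborel)"
    proof (rule nn_integral_eq_integral)
      show "integrable lborel (\<lambda>y. indicator {x..x+n} y * ?q y)"
        using borel_integrable_atLeastAtMost'[OF cont, of x "x+n"] by (simp add: set_integrable_def)
    qed (use inverse_fourier_char_nonneg[OF int] in auto)
    also have "\<dots> = ennreal (measure M {x<..x+n})"
      by (subst measure_Ioc_eq_integral_inverse_fourier[OF int]) auto
    finally show ?thesis by (simp add: emeasure_eq_measure)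
  qed
  have un: "{x<..} = (\<Union>n::nat. {x<..x + n})"
  proof safe
    fix y assume "x < y"
    obtain n :: nat where "y - x < n" using reals_Archimedean2 by blast
    with \<open>x < y\<close> show "y \<in> (\<Union>n::nat. {x<..x + n})" by (auto intro!: exI[of _ n])
  qed auto
  have inc: "incseq (\<lambda>n::nat. {x<..x + n})"
    by (auto simp: incseq_def)
  have "(SUP n::nat. emeasure M {x<..x + n}) = emeasure M {x<..}"
    unfolding un using inc by (intro SUP_emeasure_incseq) auto
  moreover have "(SUP n::nat. emeasure ?N {x<..x + n}) = emeasure ?N {x<..}"
    unfolding un using inc by (intro SUP_emeasure_incseq) auto
  ultimately show "emeasure M {x<..} = emeasure ?N {x<..}"
    by (simp add: eq)
qed auto

end

section \<open>Differentiation under the integral sign\<close>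

text \<open>
  The majorant \<open>G\<close> of the derivatives bounds the difference quotients by the mean value inequality on the
  convex set \<open>S\<close>; dominated convergence does the rest.
\<close>

lemma integral_has_field_derivative:
  fixes f f' :: "'a::{real_normed_field, banach, second_countable_topology} \<Rightarrow> 'b \<Rightarrow> 'a"
  assumes S: "open S" "convex S" "z \<in> S"
    and int: "\<And>y. y \<in> S \<Longrightarrow> integrable N (f y)"
    and deriv: "\<And>y x. y \<in> S \<Longrightarrow> x \<in> space N \<Longrightarrow> ((\<lambda>y. f y x) has_field_derivative f' y x) (at y)"
    and bound: "\<And>y x. y \<in> S \<Longrightarrow> x \<in> space N \<Longrightarrow> norm (f' y x) \<le> G x"
    and G: "integrable N G"
    and meas: "f' z \<in> borel_measurable N"
  shows "((\<lambda>y. \<integral>x. f y x \<partial>N) has_field_derivative (\<integral>x. f' z x \<partial>N)) (at z)"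
proof -
  have "((\<lambda>y. ((\<integral>x. f y x \<partial>N) - (\<integral>x. f z x \<partial>N)) / (y - z)) \<longlongrightarrow> (\<integral>x. f' z x \<partial>N)) (at z within S)"
    unfolding tendsto_at_iff_sequentially comp_def
  proof safe
    fix X :: "nat \<Rightarrow> 'a"
    assume "\<forall>i. X i \<in> S - {z}" and lim_X: "X \<longlonglongrightarrow> z"
    then have X: "X n \<in> S" "X n \<noteq> z" for n by blast+
    let ?d = "\<lambda>n x. (f (X n) x - f z x) / (X n - z)"
    have "(\<lambda>n. \<integral>x. ?d n x \<partial>N) \<longlonglongrightarrow> (\<integral>x. f' z x \<partial>N)"
    proof (rule integral_dominated_convergence[OF meas _ G])
      show "AE x in N. (\<lambda>n. ?d n x) \<longlonglongrightarrow> f' z x"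
      proof (rule AE_I2)
        fix x assume "x \<in> space N"
        from deriv[OF S(3) this] have "((\<lambda>y. (f y x - f z x) / (y - z)) \<longlongrightarrow> f' z x) (at z)"
          unfolding has_field_derivative_iff .
        moreover have "filterlim X (at z) sequentially"
          using lim_X X(2) by (simp add: filterlim_at)
        ultimately show "(\<lambda>n. ?d n x) \<longlonglongrightarrow> f' z x"
          by (rule filterlim_compose)
      qed
      show "?d n \<in> borel_measurable N" for n
        by (intro borel_measurable_divide borel_measurable_diff borel_measurable_const
            borel_measurable_integrable int X S)
      show "AE x in N. norm (?d n x) \<le> G x" for n
      proof (rule AE_I2)
        fix x assume x: "x \<in> space N"
        have "norm (f (X n) x - f z x) \<le> G x * norm (X n - z)"
        proof (rule field_differentiable_bound[OF S(2), where f="\<lambda>y. f y x" and f'="\<lambda>y. f' y x"])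
          show "((\<lambda>y. f y x) has_field_derivative f' y x) (at y within S)" if "y \<in> S" for y
            by (rule has_field_derivative_at_within[OF deriv[OF that x]])
          show "norm (f' y x) \<le> G x" if "y \<in> S" for y
            by (rule bound[OF that x])
        qed (fact X S)+
        then show "norm (?d n x) \<le> G x"
          using X(2)[of n] by (simp add: norm_divide pos_divide_le_eq)
      qed
    qed
    moreover have "(\<integral>x. ?d n x \<partial>N) = ((\<integral>x. f (X n) x \<partial>N) - (\<integral>x. f z x \<partial>N)) / (X n - z)" for n
      by (simp only: integral_divide_zero Bochner_Integration.integral_diff[OF int[OF X(1)] int[OF S(3)]])
    ultimately show "(\<lambda>n. ((\<integral>x. f (X n) x \<partial>N) - (\<integral>x. f z x \<partial>N)) / (X n - z)) \<longlonglongrightarrow> (\<integral>x. f' z x \<partial>N)"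
      by (simp only:)
  qed
  then show ?thesis
    by (simp only: has_field_derivative_iff at_within_open[OF S(3,1)])
qed

text \<open>
  A derivative computed for a holomorphic extension gives the real derivative, and it is automatically real.
  Thus it is enough to differentiate the integrals below in the complex variable.
\<close>

lemma has_real_derivative_of_complex_extension:
  fixes f :: "real \<Rightarrow> real" and F :: "complex \<Rightarrow> complex"
  assumes F: "(F has_field_derivative D) (at (of_real u))"
    and S: "open S" "u \<in> S" and eq: "\<And>v. v \<in> S \<Longrightarrow> F (of_real v) = of_real (f v)"
  shows "(f has_real_derivative deriv f u) (at u)" "D = of_real (deriv f u)"
proof -
  have "((\<lambda>v. F (of_real v)) has_vector_derivative D) (at u)"
    by (rule has_vector_derivative_real_field[OF F])
  then have vec: "((\<lambda>v. complex_of_real (f v)) has_vector_derivative D) (at u)"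
    by (rule has_vector_derivative_transform_within_open[OF _ S eq])
  from bounded_linear.has_vector_derivative[OF bounded_linear_Re vec]
  have re: "(f has_real_derivative Re D) (at u)"
    by (simp add: has_real_derivative_iff_has_vector_derivative)
  from bounded_linear.has_vector_derivative[OF bounded_linear_Im vec]
  have "((\<lambda>v. 0) has_real_derivative Im D) (at u)"
    by (simp add: has_real_derivative_iff_has_vector_derivative)
  then have im: "Im D = 0"
    by (rule DERIV_unique) simp
  from re have d: "deriv f u = Re D" by (rule DERIV_imp_deriv)
  show "(f has_real_derivative deriv f u) (at u)" using re d by simp
  show "D = of_real (deriv f u)" using im d by (simp add: complex_eq_iff)
qed

section \<open>Elementary bounds\<close>

text \<open>
  On the disc of radius \<open>Re z / 2\<close> the real part stays away from \<open>0\<close> and from infinity, which gives majorants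
  that are uniform over the disc.
\<close>

lemma ball_Re_bounds:
  assumes "y \<in> ball z (Re z / 2)"
  shows "Re z / 2 < Re y" "Re y < 3 * Re z / 2" "norm y < 2 * norm z"
proof -
  have "norm (z - y) < Re z / 2" using assms by (simp add: dist_norm)
  moreover have "\<bar>Re (z - y)\<bar> \<le> norm (z - y)" by (rule abs_Re_le_cmod)
  moreover have "norm y \<le> norm z + norm (z - y)"
    by (metis norm_triangle_sub norm_minus_commute)
  moreover have "\<bar>Re z\<bar> \<le> norm z" by (rule abs_Re_le_cmod)
  ultimately show "Re z / 2 < Re y" "Re y < 3 * Re z / 2" "norm y < 2 * norm z"
    by (auto simp: abs_if split: if_splits)
qed

lemma mult_exp_neg_le:
  fixes x r :: real
  assumes "r > 0"
  shows "x * exp (- (r * x)) \<le> 1 / r"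
proof -
  have "r * x \<le> exp (r * x)" using exp_ge_add_one_self[of "r * x"] by linarith
  then have "r * x * exp (- (r * x)) \<le> 1" by (simp add: exp_minus divide_simps)
  with assms show ?thesis by (simp add: field_simps)
qed

lemma power2_mult_exp_neg_le:
  fixes x r :: real
  assumes "r > 0" "x \<ge> 0"
  shows "x\<^sup>2 * exp (- (r * x)) \<le> 4 / r\<^sup>2"
proof -
  have "x\<^sup>2 * exp (- (r * x)) = (x * exp (- (r/2 * x)))\<^sup>2"
    by (simp add: power_mult_distrib exp_double[symmetric])
  also have "\<dots> \<le> (1 / (r/2))\<^sup>2"
    using assms by (intro power_mono mult_exp_neg_le) auto
  finally show ?thesis by (simp add: power_divide)
qed

text \<open>
  The exponential function is a contraction on the closed left half-plane, where its derivative is bounded by \<open>1\<close>.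
\<close>

lemma norm_exp_diff_le:
  fixes a b :: complex
  assumes "Re a \<le> 0" "Re b \<le> 0"
  shows "norm (exp a - exp b) \<le> norm (a - b)"
proof -
  have "norm (exp a - exp b) \<le> 1 * norm (a - b)"
  proof (rule field_differentiable_bound[where S="{u. Re u \<le> 0}" and f'=exp])
    show "convex {u. Re u \<le> 0}" by (rule convex_halfspace_Re_le)
    show "(exp has_field_derivative exp z) (at z within {u. Re u \<le> 0})" for z :: complex
      by (rule has_field_derivative_at_within[OF DERIV_exp])
    show "norm (exp z) \<le> 1" if "z \<in> {u. Re u \<le> 0}" for z
      using that by simp
  qed (use assms in simp_all)
  then show ?thesis by simp
qed

lemma norm_exp_minus_one_le:
  fixes z :: complex and x :: real
  assumes "0 \<le> Re z" "0 \<le> x"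
  shows "norm (exp (- z * of_real x) - 1) \<le> norm z * x"
proof -
  have "norm (exp (- z * of_real x) - exp 0) \<le> norm (- z * of_real x - 0)"
    using assms by (intro norm_exp_diff_le) simp_all
  then show ?thesis using assms by (simp add: norm_mult)
qed

text \<open>
  Mean value inequality for \<open>u \<mapsto> exp u - u\<close>, whose derivative is bounded by \<open>norm u\<close> on the part of the left
  half-plane within distance \<open>norm u\<close> of the origin.
\<close>

lemma norm_exp_minus_one_minus_le:
  fixes z :: complex and x :: real
  assumes "0 \<le> Re z" "0 \<le> x"
  shows "norm (exp (- z * of_real x) - 1 + z * of_real x) \<le> (norm z * x)\<^sup>2"
proof -
  define u where "u = - z * of_real x"
  have u: "Re u \<le> 0" "norm u = norm z * x" using assms by (auto simp: u_def norm_mult)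
  have "norm ((exp u - u) - (exp 0 - 0)) \<le> norm u * norm (u - 0)"
  proof (rule field_differentiable_bound[where S="{u. Re u \<le> 0} \<inter> cball 0 (norm u)" and f'="\<lambda>u. exp u - 1"])
    show "convex ({u. Re u \<le> 0} \<inter> cball 0 (norm u))"
      by (intro convex_Int convex_halfspace_Re_le convex_cball)
    fix v :: complex assume v: "v \<in> {u. Re u \<le> 0} \<inter> cball 0 (norm u)"
    then have "norm (exp v - 1) \<le> norm v"
      using norm_exp_minus_one_le[of "-v" 1] by simp
    then show "norm (exp v - 1) \<le> norm u" using v by simp
  qed (use u assms in \<open>auto intro!: derivative_eq_intros\<close>)
  then show ?thesis by (simp add: u(2)[symmetric] power2_eq_square) (simp add: u_def algebra_simps)
qed

text \<open>
  Taylor's formula of order three: \<open>cos y\<close> differs from \<open>1 - y\<^sup>2 / 2\<close> by at most \<open>y\<^sup>4 / 24\<close>.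
\<close>

lemma one_minus_cos_ge:
  fixes y :: real
  assumes "\<bar>y\<bar> \<le> 1"
  shows "y\<^sup>2 / 4 \<le> 1 - cos y"
proof -
  have y2: "y\<^sup>2 \<le> 1" using assms by (simp add: abs_square_le_1)
  have "\<bar>Re (iexp y - (\<Sum>k\<le>3. (\<i> * y)^k / fact k))\<bar> \<le> \<bar>y\<bar>^(Suc 3) / fact (Suc 3)"
    by (rule order_trans[OF abs_Re_le_cmod iexp_approx1])
  then have "\<bar>cos y - (1 - y\<^sup>2 / 2)\<bar> \<le> y^4 / 24"
    by (simp add: eval_nat_numeral Re_exp power_mult_distrib)
  then have "cos y - (1 - y\<^sup>2 / 2) \<le> y^4 / 24" by (rule abs_le_D1)
  moreover have "y^4 \<le> y\<^sup>2"
    using mult_left_mono[OF y2, of "y\<^sup>2"] by (simp add: power2_eq_square eval_nat_numeral mult.assoc)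
  moreover have "0 \<le> y\<^sup>2" by simp
  ultimately show ?thesis by linarith
qed

section \<open>Laplace transforms of measures on the real line\<close>

lemma laplace_transform_integrable:
  fixes N :: "real measure"
  assumes "sets N = sets borel" "\<And>u::real. 0 < u \<Longrightarrow> integrable N (\<lambda>x. exp (- u * x))" "0 < Re z"
  shows "integrable N (\<lambda>x. exp (- z * of_real x))"
proof (rule Bochner_Integration.integrable_bound[OF assms(2)[OF assms(3)]])
  note [measurable_cong] = assms(1)
  show "(\<lambda>x. exp (- z * of_real x)) \<in> borel_measurable N" by measurable
  show "AE x in N. norm (exp (- z * of_real x)) \<le> norm (exp (- Re z * x))"
    by (rule AE_I2) (simp add: norm_exp_eq_Re)
qed

text \<open>
  The factor \<open>\<bar>x\<bar>\<close> is absorbed by \<open>exp (a / 4 * \<bar>x\<bar>)\<close>. The right-hand side, an integrable function in the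
  application, depends on \<open>r\<close> only through the interval \<open>(a / 2, 3 * a / 2)\<close>.
\<close>

lemma abs_mult_exp_le:
  fixes x r a :: real
  assumes "0 < a" "a / 2 < r" "r < 3 * a / 2"
  shows "\<bar>x\<bar> * exp (- (r * x)) \<le> 4 / a * (exp (- (a / 4) * x) + exp (- (2 * a) * x))"
proof -
  have "a / 4 * \<bar>x\<bar> \<le> exp (a / 4 * \<bar>x\<bar>)"
    using exp_ge_add_one_self[of "a / 4 * \<bar>x\<bar>"] by linarith
  then have "\<bar>x\<bar> \<le> 4 / a * exp (a / 4 * \<bar>x\<bar>)"
    using assms by (simp add: field_simps)
  then have "\<bar>x\<bar> * exp (- (r * x)) \<le> 4 / a * exp (a / 4 * \<bar>x\<bar>) * exp (- (r * x))"
    by (intro mult_right_mono) auto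
  also have "\<dots> = 4 / a * exp (a / 4 * \<bar>x\<bar> - r * x)"
    by (simp add: exp_add[symmetric])
  also have "\<dots> \<le> 4 / a * (exp (- (a / 4) * x) + exp (- (2 * a) * x))"
  proof (rule mult_left_mono)
    show "exp (a / 4 * \<bar>x\<bar> - r * x) \<le> exp (- (a / 4) * x) + exp (- (2 * a) * x)"
    proof (cases "x \<ge> 0")
      case True
      then have "a / 2 * x \<le> r * x"
        using assms by (intro mult_right_mono) auto
      with True have "exp (a / 4 * \<bar>x\<bar> - r * x) \<le> exp (- (a / 4) * x)" by simp
      also have "\<dots> \<le> exp (- (a / 4) * x) + exp (- (2 * a) * x)"
        by (simp only: le_add_same_cancel1 exp_ge_zero)
      finally show ?thesis .
    next
      case False
      then have "r * (- x) \<le> 3 * a / 2 * (- x)" "0 \<le> a * (- x)"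
        using assms by (intro mult_right_mono mult_nonneg_nonneg; simp)+
      moreover have "\<bar>x\<bar> = - x" using False by simp
      ultimately have "exp (a / 4 * \<bar>x\<bar> - r * x) \<le> exp (- (2 * a) * x)" by simp
      also have "\<dots> \<le> exp (- (a / 4) * x) + exp (- (2 * a) * x)"
        by (simp only: le_add_same_cancel2 exp_ge_zero)
      finally show ?thesis .
    qed
    show "0 \<le> 4 / a" using assms(1) by simp
  qed
  finally show ?thesis .
qed

lemma laplace_transform_holomorphic:
  fixes N :: "real measure"
  assumes N: "sets N = sets borel" and int: "\<And>u::real. 0 < u \<Longrightarrow> integrable N (\<lambda>x. exp (- u * x))"
  shows "(\<lambda>z. \<integral>x. exp (- z * of_real x) \<partial>N) holomorphic_on {z. 0 < Re z}"
  unfolding holomorphic_on_def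
proof safe
  fix z assume z: "0 < Re z"
  note [measurable_cong] = N
  have "((\<lambda>z. \<integral>x. exp (- z * of_real x) \<partial>N) has_field_derivative
      (\<integral>x. - of_real x * exp (- z * of_real x) \<partial>N)) (at z)"
  proof (rule integral_has_field_derivative[where S="ball z (Re z / 2)" and z=z and N=N
        and f="\<lambda>z x. exp (- z * of_real x)"
        and G="\<lambda>x. 4 / Re z * (exp (- (Re z / 4) * x) + exp (- (2 * Re z) * x))"
        and f'="\<lambda>z x. - of_real x * exp (- z * of_real x)"])
    fix y x assume y: "y \<in> ball z (Re z / 2)"
    note b = ball_Re_bounds[OF y]
    show "integrable N (\<lambda>x. exp (- y * of_real x))"
      using N int b z by (intro laplace_transform_integrable) auto
    show "((\<lambda>y. exp (- y * of_real x)) has_field_derivative - of_real x * exp (- y * of_real x)) (at y)"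
      by (auto intro!: derivative_eq_intros)
    have "norm (- of_real x * exp (- y * of_real x)) = \<bar>x\<bar> * exp (- (Re y * x))"
      by (simp add: norm_mult)
    also have "\<dots> \<le> 4 / Re z * (exp (- (Re z / 4) * x) + exp (- (2 * Re z) * x))"
      using abs_mult_exp_le[OF z b(1,2)] .
    finally show "norm (- of_real x * exp (- y * of_real x)) \<le> 4 / Re z * (exp (- (Re z / 4) * x) + exp (- (2 * Re z) * x))" .
  next
    show "integrable N (\<lambda>x. 4 / Re z * (exp (- (Re z / 4) * x) + exp (- (2 * Re z) * x)))"
      by (intro integrable_mult_right Bochner_Integration.integrable_add int) (use z in auto)
    show "(\<lambda>x. - of_real x * exp (- z * of_real x)) \<in> borel_measurable N"
      by measurable
    show "z \<in> ball z (Re z / 2)" using z by simp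
    show "open (ball z (Re z / 2))" by simp
    show "convex (ball z (Re z / 2))" by simp
  qed
  then show "(\<lambda>z. \<integral>x. exp (- z * of_real x) \<partial>N) field_differentiable at z within {z. 0 < Re z}"
    unfolding field_differentiable_def by (intro exI) (rule has_field_derivative_at_within)
qed

section \<open>The Laplace exponent on the right half-plane\<close>

text \<open>
  The Levy--Khintchine formula with a complex argument.
\<close>

definition complex_exponent :: "real \<Rightarrow> real \<Rightarrow> real measure \<Rightarrow> complex \<Rightarrow> complex" where
  "complex_exponent \<sigma> b \<nu> z = of_real (\<sigma>\<^sup>2) * z\<^sup>2 - of_real b * z
     + (\<integral>x. (exp (- z * of_real x) - 1 + z * of_real (x * indicator {..<1} x)) \<partial>\<nu>)"

text \<open>
  The part of \<open>\<phi>''\<close> that is due to the jumps.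
\<close>

definition second_moment :: "real measure \<Rightarrow> real \<Rightarrow> real" where
  "second_moment \<nu> w = (\<integral>x. x\<^sup>2 * exp (- w * x) \<partial>\<nu>)"

context
  fixes \<nu> :: "real measure"
  assumes \<nu>: "levy_measure_pos \<nu>"
begin

lemma sets_levy_measure [measurable_cong]: "sets \<nu> = sets (restrict_space borel {0<..})"
  using \<nu> by (simp add: levy_measure_pos_def)

lemma space_levy_measure: "space \<nu> = {0<..}"
  using sets_eq_imp_space_eq[OF sets_levy_measure] by (simp add: space_restrict_space)

lemma measurable_levy_measure: "f \<in> borel_measurable borel \<Longrightarrow> f \<in> borel_measurable \<nu>"
  unfolding measurable_cong_sets[OF sets_levy_measure refl] by (rule measurable_restrict_space1)

lemma integrable_min_levy_measure: "integrable \<nu> (\<lambda>x. min 1 (x\<^sup>2))"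
proof (rule integrableI_nonneg)
  show "(\<integral>\<^sup>+x. ennreal (min 1 (x\<^sup>2)) \<partial>\<nu>) < \<infinity>" using \<nu> by (simp add: levy_measure_pos_def)
qed (auto intro!: measurable_levy_measure)

text \<open>
  A function of order \<open>x\<^sup>2\<close> near \<open>0\<close> that is bounded at infinity is integrable against a Levy measure.
\<close>

lemma integrable_levy_measureI:
  fixes f :: "real \<Rightarrow> 'b::{banach, second_countable_topology}"
  assumes "f \<in> borel_measurable borel" and "\<And>x. 0 < x \<Longrightarrow> norm (f x) \<le> C * min 1 (x\<^sup>2)"
  shows "integrable \<nu> f"
proof (rule Bochner_Integration.integrable_bound[where f="\<lambda>x. C * min 1 (x\<^sup>2)"])
  show "AE x in \<nu>. norm (f x) \<le> norm (C * min 1 (x\<^sup>2))"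
    using assms(2) by (intro AE_I2) (fastforce simp: space_levy_measure)
qed (use assms integrable_min_levy_measure measurable_levy_measure in auto)

lemma integrable_second_moment:
  assumes "0 < w"
  shows "integrable \<nu> (\<lambda>x. x\<^sup>2 * exp (- w * x))"
proof (rule integrable_levy_measureI[where C="1 + 4 / w\<^sup>2"])
  fix x :: real assume x: "0 < x"
  have "x\<^sup>2 * exp (- w * x) \<le> (1 + 4 / w\<^sup>2) * min 1 (x\<^sup>2)"
  proof (cases "x \<le> 1")
    case True
    have "x\<^sup>2 * exp (- w * x) \<le> x\<^sup>2 * 1"
      using assms x by (intro mult_left_mono) auto
    also have "\<dots> \<le> (1 + 4 / w\<^sup>2) * x\<^sup>2"
      by (simp add: algebra_simps)
    finally show ?thesis using True x by (simp add: min_absorb2 power_le_one)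
  next
    case False
    then have "1 \<le> x\<^sup>2" by simp
    moreover have "x\<^sup>2 * exp (- (w * x)) \<le> 4 / w\<^sup>2" using power2_mult_exp_neg_le[of w x] assms x by auto
    ultimately show ?thesis by (simp add: min_absorb1)
  qed
  then show "norm (x\<^sup>2 * exp (- w * x)) \<le> (1 + 4 / w\<^sup>2) * min 1 (x\<^sup>2)" by simp
qed auto

lemma integrable_jump_kernel:
  assumes "0 \<le> Re z"
  shows "integrable \<nu> (\<lambda>x. exp (- z * of_real x) - 1 + z * of_real (x * indicator {..<1} x))"
proof (rule integrable_levy_measureI[where C="2 + (norm z)\<^sup>2"])
  fix x :: real assume x: "0 < x"
  show "norm (exp (- z * of_real x) - 1 + z * of_real (x * indicator {..<1} x)) \<le> (2 + (norm z)\<^sup>2) * min 1 (x\<^sup>2)"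
  proof (cases "x < 1")
    case True
    then have "norm (exp (- z * of_real x) - 1 + z * of_real (x * indicator {..<1} x)) \<le> (norm z * x)\<^sup>2"
      using norm_exp_minus_one_minus_le[OF assms, of x] x by simp
    also have "\<dots> \<le> (2 + (norm z)\<^sup>2) * x\<^sup>2"
      by (simp add: power_mult_distrib algebra_simps)
    finally show ?thesis using True x by (simp add: min_absorb2 power_le_one)
  next
    case False
    have "norm (exp (- z * of_real x) - 1) \<le> norm (exp (- z * of_real x)) + norm (1::complex)"
      by (rule norm_triangle_ineq4)
    also have "\<dots> \<le> 1 + 1"
      using assms x by (intro add_mono) auto
    finally have "norm (exp (- z * of_real x) - 1) \<le> 2" by simp
    moreover have "1 \<le> x\<^sup>2" using False by simp
    ultimately show ?thesis using False by (simp add: min_absorb1 add_increasing2)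
  qed
qed measurable

text \<open>
  The compensator cancels the linear term for \<open>x < 1\<close>; for \<open>x \<ge> 1\<close> the exponential beats the factor \<open>x\<close>.
\<close>

lemma norm_jump_kernel_deriv_le:
  fixes z :: complex and x :: real
  assumes z: "0 < Re z" and x: "0 < x"
  shows "norm (of_real (x * indicator {..<1} x) - of_real x * exp (- z * of_real x)) \<le> (norm z + 1 / Re z) * min 1 (x\<^sup>2)"
proof (cases "x < 1")
  case True
  have "of_real (x * indicator {..<1} x) - of_real x * exp (- z * of_real x) = of_real x * (- (exp (- z * of_real x) - 1))"
    using True by (simp add: right_diff_distrib)
  also have "norm \<dots> = x * norm (exp (- z * of_real x) - 1)"
    using x by (simp only: norm_mult norm_minus_cancel) simp
  also have "\<dots> \<le> x * (norm z * x)"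
    using x z by (intro mult_left_mono norm_exp_minus_one_le) auto
  also have "\<dots> \<le> (norm z + 1 / Re z) * x\<^sup>2"
    using z by (simp add: power2_eq_square algebra_simps)
  finally show ?thesis using True x by (simp add: min_absorb2 power_le_one)
next
  case False
  have "norm (of_real (x * indicator {..<1} x) - of_real x * exp (- z * of_real x)) = x * exp (- (Re z * x))"
    using False by (simp add: norm_mult)
  also have "\<dots> \<le> 1 / Re z" using z by (intro mult_exp_neg_le) auto
  also have "\<dots> \<le> norm z + 1 / Re z" by simp
  finally have "norm (of_real (x * indicator {..<1} x) - of_real x * exp (- z * of_real x)) \<le> norm z + 1 / Re z" .
  moreover have "1 \<le> x\<^sup>2" using False by simp
  ultimately show ?thesis by (simp add: min_absorb1)
qed

lemma integrable_jump_kernel_deriv: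
  assumes "0 < Re z"
  shows "integrable \<nu> (\<lambda>x. of_real (x * indicator {..<1} x) - of_real x * exp (- z * of_real x))"
  by (rule integrable_levy_measureI[OF _ norm_jump_kernel_deriv_le[OF assms]]) measurable

lemma jump_integral_has_field_derivative:
  assumes z: "0 < Re z"
  shows "((\<lambda>z. \<integral>x. (exp (- z * of_real x) - 1 + z * of_real (x * indicator {..<1} x)) \<partial>\<nu>) has_field_derivative
    (\<integral>x. (of_real (x * indicator {..<1} x) - of_real x * exp (- z * of_real x)) \<partial>\<nu>)) (at z)"
proof (rule integral_has_field_derivative[where S="ball z (Re z / 2)" and z=z and N=\<nu>
        and f="\<lambda>z x. exp (- z * of_real x) - 1 + z * of_real (x * indicator {..<1} x)"
        and G="\<lambda>x. (2 * norm z + 2 / Re z) * min 1 (x\<^sup>2)"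
        and f'="\<lambda>z x. of_real (x * indicator {..<1} x) - of_real x * exp (- z * of_real x)"])
  fix y x assume y: "y \<in> ball z (Re z / 2)"
  note b = ball_Re_bounds[OF y]
  show "integrable \<nu> (\<lambda>x. exp (- y * of_real x) - 1 + y * of_real (x * indicator {..<1} x))"
    using b z by (intro integrable_jump_kernel) auto
  show "((\<lambda>y. exp (- y * of_real x) - 1 + y * of_real (x * indicator {..<1} x)) has_field_derivative
      of_real (x * indicator {..<1} x) - of_real x * exp (- y * of_real x)) (at y)"
    by (auto intro!: derivative_eq_intros)
  assume "x \<in> space \<nu>"
  then have "norm (of_real (x * indicator {..<1} x) - of_real x * exp (- y * of_real x)) \<le> (norm y + 1 / Re y) * min 1 (x\<^sup>2)"
    using b z by (intro norm_jump_kernel_deriv_le) (auto simp: space_levy_measure)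
  also have "1 / Re y \<le> 2 / Re z" using b z by (simp add: field_simps)
  with b have "(norm y + 1 / Re y) * min 1 (x\<^sup>2) \<le> (2 * norm z + 2 / Re z) * min 1 (x\<^sup>2)"
    by (intro mult_right_mono add_mono) auto
  finally show "norm (of_real (x * indicator {..<1} x) - of_real x * exp (- y * of_real x)) \<le> (2 * norm z + 2 / Re z) * min 1 (x\<^sup>2)" .
next
  show "(\<lambda>x. of_real (x * indicator {..<1} x) - of_real x * exp (- z * of_real x)) \<in> borel_measurable \<nu>"
    by (intro measurable_levy_measure) measurable
next
  show "integrable \<nu> (\<lambda>x. (2 * norm z + 2 / Re z) * min 1 (x\<^sup>2))"
    by (intro integrable_mult_right integrable_min_levy_measure)
  show "z \<in> ball z (Re z / 2)" using z by simp
  show "open (ball z (Re z / 2))" "convex (ball z (Re z / 2))" by simp_all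
qed

lemma jump_integral_deriv_has_field_derivative:
  assumes z: "0 < Re z"
  shows "((\<lambda>z. \<integral>x. (of_real (x * indicator {..<1} x) - of_real x * exp (- z * of_real x)) \<partial>\<nu>) has_field_derivative
    (\<integral>x. of_real (x\<^sup>2) * exp (- z * of_real x) \<partial>\<nu>)) (at z)"
proof (rule integral_has_field_derivative[where S="ball z (Re z / 2)" and z=z and N=\<nu>
        and f="\<lambda>z x. of_real (x * indicator {..<1} x) - of_real x * exp (- z * of_real x)"
        and G="\<lambda>x. x\<^sup>2 * exp (- (Re z / 2) * x)"
        and f'="\<lambda>z x. of_real (x\<^sup>2) * exp (- z * of_real x)"])
  fix y x assume y: "y \<in> ball z (Re z / 2)"
  note b = ball_Re_bounds[OF y]
  show "integrable \<nu> (\<lambda>x. of_real (x * indicator {..<1} x) - of_real x * exp (- y * of_real x))"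
    using b z by (intro integrable_jump_kernel_deriv) auto
  show "((\<lambda>y. of_real (x * indicator {..<1} x) - of_real x * exp (- y * of_real x)) has_field_derivative
      of_real (x\<^sup>2) * exp (- y * of_real x)) (at y)"
    by (auto intro!: derivative_eq_intros simp: power2_eq_square)
  assume "x \<in> space \<nu>"
  then show "norm (of_real (x\<^sup>2) * exp (- y * of_real x)) \<le> x\<^sup>2 * exp (- (Re z / 2) * x)"
    using b by (auto simp: norm_mult space_levy_measure norm_power intro!: mult_left_mono mult_right_mono)
next
  show "(\<lambda>x. of_real (x\<^sup>2) * exp (- z * of_real x)) \<in> borel_measurable \<nu>"
    by (intro measurable_levy_measure) measurable
next
  show "integrable \<nu> (\<lambda>x. x\<^sup>2 * exp (- (Re z / 2) * x))"
    using z by (intro integrable_second_moment) auto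
  show "z \<in> ball z (Re z / 2)" using z by simp
  show "open (ball z (Re z / 2))" "convex (ball z (Re z / 2))" by simp_all
qed

end

definition complex_exponent_deriv :: "real \<Rightarrow> real \<Rightarrow> real measure \<Rightarrow> complex \<Rightarrow> complex" where
  "complex_exponent_deriv \<sigma> b \<nu> z = of_real (2 * \<sigma>\<^sup>2) * z - of_real b
     + (\<integral>x. (of_real (x * indicator {..<1} x) - of_real x * exp (- z * of_real x)) \<partial>\<nu>)"

context
  fixes \<phi> :: "real \<Rightarrow> real" and \<sigma> b :: real and \<nu> :: "real measure"
  assumes LK: "levy_khintchine \<phi> \<sigma> b \<nu>"
begin

lemma levy_measure: "levy_measure_pos \<nu>"
  using LK by (simp add: levy_khintchine_def)

lemma complex_exponent_of_real:
  assumes "0 \<le> u"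
  shows "complex_exponent \<sigma> b \<nu> (of_real u) = of_real (\<phi> u)"
proof -
  have "(\<integral>x. (exp (- of_real u * of_real x) - 1 + of_real u * of_real (x * indicator {..<1} x)) \<partial>\<nu>)
      = complex_of_real (\<integral>x. (exp (- u * x) - 1 + u * x * indicator {..<1} x) \<partial>\<nu>)"
    unfolding integral_complex_of_real[symmetric]
    by (intro Bochner_Integration.integral_cong refl) (simp add: exp_of_real[symmetric])
  moreover have "\<phi> u = \<sigma>\<^sup>2 * u\<^sup>2 - b * u + (\<integral>x. (exp (- u * x) - 1 + u * x * indicator {..<1} x) \<partial>\<nu>)"
    using LK assms unfolding levy_khintchine_def by blast
  ultimately show ?thesis
    unfolding complex_exponent_def by (simp only: of_real_add of_real_diff of_real_mult of_real_power)
qed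

lemma complex_exponent_has_field_derivative:
  assumes "0 < Re z"
  shows "(complex_exponent \<sigma> b \<nu> has_field_derivative complex_exponent_deriv \<sigma> b \<nu> z) (at z)"
  unfolding complex_exponent_def[abs_def] complex_exponent_deriv_def
  by (rule derivative_eq_intros jump_integral_has_field_derivative[OF levy_measure assms] refl)+ simp

lemma complex_exponent_deriv_has_field_derivative:
  assumes "0 < Re z"
  shows "(complex_exponent_deriv \<sigma> b \<nu> has_field_derivative
    of_real (2 * \<sigma>\<^sup>2) + (\<integral>x. of_real (x\<^sup>2) * exp (- z * of_real x) \<partial>\<nu>)) (at z)"
  unfolding complex_exponent_deriv_def[abs_def]
  by (rule derivative_eq_intros jump_integral_deriv_has_field_derivative[OF levy_measure assms] refl)+ simp

lemma complex_exponent_deriv_of_real: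
  assumes "0 < w"
  shows "complex_exponent_deriv \<sigma> b \<nu> (of_real w) = of_real (deriv \<phi> w)"
  by (rule has_real_derivative_of_complex_extension(2)[OF complex_exponent_has_field_derivative, where S="{0<..}"])
     (use assms in \<open>auto simp: complex_exponent_of_real\<close>)

text \<open>
  Differentiating twice removes the drift and the compensator. What remains shows that \<open>\<phi>''\<close> is nonnegative
  and nonincreasing.
\<close>

lemma deriv_deriv_exponent:
  assumes "0 < w"
  shows "deriv (deriv \<phi>) w = 2 * \<sigma>\<^sup>2 + second_moment \<nu> w"
proof -
  have "of_real (2 * \<sigma>\<^sup>2) + (\<integral>x. of_real (x\<^sup>2) * exp (- of_real w * of_real x) \<partial>\<nu>)
      = complex_of_real (deriv (deriv \<phi>) w)"
    by (rule has_real_derivative_of_complex_extension(2)[OF complex_exponent_deriv_has_field_derivative, where S="{0<..}"])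
       (use assms in \<open>auto simp: complex_exponent_deriv_of_real\<close>)
  moreover have "(\<integral>x. of_real (x\<^sup>2) * exp (- of_real w * of_real x) \<partial>\<nu>) = complex_of_real (second_moment \<nu> w)"
    unfolding second_moment_def integral_complex_of_real[symmetric]
    by (intro Bochner_Integration.integral_cong refl) (simp add: exp_of_real[symmetric])
  ultimately show ?thesis
    by (simp only: of_real_add[symmetric] of_real_eq_iff)
qed

lemma second_moment_nonneg: "0 \<le> second_moment \<nu> w"
  unfolding second_moment_def by (intro integral_nonneg_AE AE_I2) simp

lemma second_moment_antimono:
  assumes "0 < v" "v \<le> w"
  shows "second_moment \<nu> w \<le> second_moment \<nu> v"
  unfolding second_moment_def
proof (rule integral_mono)
  fix x assume "x \<in> space \<nu>"
  then have "0 < x" by (simp add: space_levy_measure[OF levy_measure])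
  then show "x\<^sup>2 * exp (- w * x) \<le> x\<^sup>2 * exp (- v * x)"
    using assms by (intro mult_left_mono) auto
qed (rule integrable_second_moment[OF levy_measure], use assms in simp)+

text \<open>
  On a vertical line the truncation of the compensator disappears: subtracting the value and the linear term
  \<open>- i \<xi> \<phi>' w\<close> at \<open>w\<close> leaves the centred exponent of the tilted process, whose Levy measure is
  \<open>exp (- w x) \<nu>(dx)\<close>.
\<close>

lemma complex_exponent_vertical_line:
  fixes w \<xi> :: real
  assumes w: "0 < w"
  defines "k \<equiv> \<lambda>x. exp (- w * x) *\<^sub>R (iexp (\<xi> * x) - 1 - \<i> * of_real (\<xi> * x))"
  shows "integrable \<nu> k"
    and "complex_exponent \<sigma> b \<nu> (of_real w - \<i> * of_real \<xi>) =
      of_real (\<phi> w) - \<i> * of_real \<xi> * of_real (deriv \<phi> w) - of_real (\<sigma>\<^sup>2 * \<xi>\<^sup>2) + (\<integral>x. k x \<partial>\<nu>)"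
proof -
  let ?z = "of_real w - \<i> * of_real \<xi>"
  let ?j = "\<lambda>z x. exp (- z * complex_of_real x) - 1 + z * of_real (x * indicator {..<1} x)"
  let ?d = "\<lambda>x. complex_of_real (x * indicator {..<1} x) - of_real x * exp (- of_real w * of_real x)"
  have eq: "k x = ?j ?z x - ?j (of_real w) x + \<i> * of_real \<xi> * ?d x" for x
  proof -
    have "exp (- ?z * of_real x) = exp (- of_real w * of_real x) * iexp (\<xi> * x)"
      by (simp only: exp_add[symmetric]) (simp add: algebra_simps)
    then show ?thesis
      by (simp add: k_def scaleR_conv_of_real exp_of_real[symmetric] algebra_simps)
  qed
  have i1: "integrable \<nu> (?j ?z)" and i2: "integrable \<nu> (?j (of_real w))" and i3: "integrable \<nu> ?d"
    using w by (intro integrable_jump_kernel[OF levy_measure] integrable_jump_kernel_deriv[OF levy_measure]; simp)+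
  show "integrable \<nu> k"
    unfolding eq[abs_def] by (intro Bochner_Integration.integrable_add Bochner_Integration.integrable_diff i1 i2 i3 integrable_mult_right)
  have "(\<integral>x. k x \<partial>\<nu>) = (\<integral>x. ?j ?z x \<partial>\<nu>) - (\<integral>x. ?j (of_real w) x \<partial>\<nu>) + \<i> * of_real \<xi> * (\<integral>x. ?d x \<partial>\<nu>)"
    unfolding eq Bochner_Integration.integral_add[OF Bochner_Integration.integrable_diff[OF i1 i2] integrable_mult_right[OF i3]]
      Bochner_Integration.integral_diff[OF i1 i2] integral_mult_right_zero ..
  moreover define I1 I2 I3 where "I1 = (\<integral>x. ?j ?z x \<partial>\<nu>)" "I2 = (\<integral>x. ?j (of_real w) x \<partial>\<nu>)" "I3 = (\<integral>x. ?d x \<partial>\<nu>)"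
  ultimately have "(\<integral>x. k x \<partial>\<nu>) = I1 - I2 + \<i> * of_real \<xi> * I3" by (simp only:)
  moreover have "complex_exponent \<sigma> b \<nu> ?z = of_real (\<sigma>\<^sup>2) * ?z\<^sup>2 - of_real b * ?z + I1"
    unfolding I1_I2_I3_def by (rule complex_exponent_def)
  moreover have "of_real (\<phi> w) = of_real (\<sigma>\<^sup>2) * (of_real w)\<^sup>2 - of_real b * of_real w + I2"
    unfolding I1_I2_I3_def complex_exponent_of_real[OF less_imp_le[OF w], symmetric] by (rule complex_exponent_def)
  moreover have "of_real (deriv \<phi> w) = of_real (2 * \<sigma>\<^sup>2) * of_real w - of_real b + I3"
    unfolding I1_I2_I3_def complex_exponent_deriv_of_real[OF w, symmetric] by (rule complex_exponent_deriv_def)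
  ultimately show "complex_exponent \<sigma> b \<nu> ?z =
      of_real (\<phi> w) - \<i> * of_real \<xi> * of_real (deriv \<phi> w) - of_real (\<sigma>\<^sup>2 * \<xi>\<^sup>2) + (\<integral>x. k x \<partial>\<nu>)"
    by (simp only:) (simp add: power2_eq_square algebra_simps)
qed

text \<open>
  The second order term of the exponential integrates to \<open>\<xi>\<^sup>2 \<phi>'' w / 2\<close>, so that the error is at most the
  third moment. One factor \<open>x\<close> of this moment costs half of the exponential damping, since
  \<open>x exp (- w x / 2) \<le> 2 / w\<close>; hence \<open>\<phi>''\<close> at \<open>w / 2\<close>.
\<close>

lemma complex_exponent_gaussian_approx:
  fixes w \<xi> :: real
  assumes w: "0 < w"
  shows "norm (complex_exponent \<sigma> b \<nu> (of_real w - \<i> * of_real \<xi>) - of_real (\<phi> w)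
      + \<i> * of_real \<xi> * of_real (deriv \<phi> w) + of_real (\<xi>\<^sup>2 * deriv (deriv \<phi>) w / 2))
    \<le> \<bar>\<xi>\<bar>^3 / (3 * w) * deriv (deriv \<phi>) (w / 2)"
proof -
  let ?k = "\<lambda>x. exp (- w * x) *\<^sub>R (iexp (\<xi> * x) - 1 - \<i> * of_real (\<xi> * x))"
  let ?q = "\<lambda>x. complex_of_real (\<xi>\<^sup>2 / 2 * (x\<^sup>2 * exp (- w * x)))"
  have int_q: "integrable \<nu> ?q"
    by (intro integrable_of_real integrable_mult_right integrable_second_moment[OF levy_measure w])
  note int_k = complex_exponent_vertical_line(1)[OF w]
  have "(\<integral>x. ?q x \<partial>\<nu>) = of_real (\<xi>\<^sup>2 / 2 * second_moment \<nu> w)"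
    by (simp only: integral_complex_of_real integral_mult_right_zero second_moment_def)
  then have eq: "complex_exponent \<sigma> b \<nu> (of_real w - \<i> * of_real \<xi>) - of_real (\<phi> w)
      + \<i> * of_real \<xi> * of_real (deriv \<phi> w) + of_real (\<xi>\<^sup>2 * deriv (deriv \<phi>) w / 2)
      = (\<integral>x. ?k x \<partial>\<nu>) + (\<integral>x. ?q x \<partial>\<nu>)"
    unfolding complex_exponent_vertical_line(2)[OF w] deriv_deriv_exponent[OF w]
    by (simp only: of_real_add of_real_mult of_real_divide ring_distribs add_divide_distrib) simp
  have "norm (\<integral>x. ?k x + ?q x \<partial>\<nu>) \<le> (\<integral>x. \<bar>\<xi>\<bar>^3 / (3 * w) * (x\<^sup>2 * exp (- (w / 2) * x)) \<partial>\<nu>)"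
  proof (rule Bochner_Integration.integral_norm_bound_integral)
    show "integrable \<nu> (\<lambda>x. ?k x + ?q x)" by (rule Bochner_Integration.integrable_add[OF int_k int_q])
    show "integrable \<nu> (\<lambda>x. \<bar>\<xi>\<bar>^3 / (3 * w) * (x\<^sup>2 * exp (- (w / 2) * x)))"
      using w by (intro integrable_mult_right integrable_second_moment[OF levy_measure]) simp
    fix x assume "x \<in> space \<nu>"
    then have x: "0 < x" by (simp add: space_levy_measure[OF levy_measure])
    have keq: "?k x + ?q x = exp (- w * x) *\<^sub>R (iexp (\<xi> * x) - (\<Sum>k\<le>2. (\<i> * (\<xi> * x))^k / fact k))"
      by (simp add: eval_nat_numeral scaleR_conv_of_real algebra_simps)
    have "norm (?k x + ?q x) = exp (- w * x) * norm (iexp (\<xi> * x) - (\<Sum>k\<le>2. (\<i> * (\<xi> * x))^k / fact k))"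
      by (simp only: keq norm_scaleR abs_exp_cancel)
    also have "\<dots> \<le> exp (- w * x) * (\<bar>\<xi> * x\<bar>^Suc 2 / fact (Suc 2))"
      using iexp_approx1[of "\<xi> * x" 2] by (intro mult_left_mono) (simp_all only: of_real_mult exp_ge_zero)
    also have "\<dots> = \<bar>\<xi>\<bar>^3 / 6 * (x\<^sup>2 * exp (- (w / 2) * x)) * (x * exp (- (w / 2 * x)))"
    proof -
      have "exp (- w * x) = exp (- (w / 2) * x) * exp (- (w / 2 * x))"
        by (simp add: exp_add[symmetric])
      moreover have "\<bar>\<xi> * x\<bar>^Suc 2 / fact (Suc 2) = \<bar>\<xi>\<bar>^3 / 6 * (x\<^sup>2 * x)"
        using x by (simp add: eval_nat_numeral abs_mult)
      ultimately show ?thesis by (simp only: mult_ac)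
    qed
    also have "\<dots> \<le> \<bar>\<xi>\<bar>^3 / 6 * (x\<^sup>2 * exp (- (w / 2) * x)) * (1 / (w / 2))"
      using w by (intro mult_left_mono mult_exp_neg_le) auto
    also have "\<dots> = \<bar>\<xi>\<bar>^3 / (3 * w) * (x\<^sup>2 * exp (- (w / 2) * x))"
      by simp
    finally show "norm (?k x + ?q x) \<le> \<bar>\<xi>\<bar>^3 / (3 * w) * (x\<^sup>2 * exp (- (w / 2) * x))" .
  qed
  also have "\<dots> = \<bar>\<xi>\<bar>^3 / (3 * w) * second_moment \<nu> (w / 2)"
    by (simp only: integral_mult_right_zero second_moment_def)
  also have "\<dots> \<le> \<bar>\<xi>\<bar>^3 / (3 * w) * deriv (deriv \<phi>) (w / 2)"
    using w by (intro mult_left_mono) (auto simp: deriv_deriv_exponent)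
  finally show ?thesis
    by (simp only: eq Bochner_Integration.integral_add[OF int_k int_q])
qed

text \<open>
  With \<open>Q = x\<^sup>2 (exp (- 2 L x) - exp (- A) exp (- L x))\<close> it is enough to see that
  \<open>\<xi>\<^sup>2 / 4 * Q \<le> exp (- w x) (1 - cos (\<xi> x))\<close> for every jump size \<open>x\<close>. For \<open>\<bar>\<xi>\<bar> x \<le> 1\<close> this is the quadratic
  lower bound for \<open>1 - cos\<close>. For \<open>\<bar>\<xi>\<bar> x > 1\<close> the choice of \<open>L\<close> gives \<open>L x \<ge> A\<close>, so that \<open>Q \<le> 0\<close>.
  Thus a difference of two values of \<open>\<phi>''\<close> stands in for a truncated second moment.
\<close>

lemma Re_complex_exponent_decay:
  fixes w \<xi> A :: real
  assumes w: "0 < w" and A: "0 \<le> A"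
  defines "L \<equiv> w + A * \<bar>\<xi>\<bar>"
  shows "\<xi>\<^sup>2 / 4 * (deriv (deriv \<phi>) (2 * L) - exp (- A) * deriv (deriv \<phi>) L)
    \<le> \<phi> w - Re (complex_exponent \<sigma> b \<nu> (of_real w - \<i> * of_real \<xi>))"
proof -
  let ?k = "\<lambda>x. exp (- w * x) *\<^sub>R (iexp (\<xi> * x) - 1 - \<i> * of_real (\<xi> * x))"
  have L: "0 < L" "w \<le> L" unfolding L_def using w A by (auto intro: add_pos_nonneg)
  note int_k = complex_exponent_vertical_line(1)[OF w]
  have int: "integrable \<nu> (\<lambda>x. x\<^sup>2 * exp (- L * x))" "integrable \<nu> (\<lambda>x. x\<^sup>2 * exp (- (2 * L) * x))"
    by (rule integrable_second_moment[OF levy_measure], use L in simp)+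
  have "\<xi>\<^sup>2 / 4 * (second_moment \<nu> (2 * L) - exp (- A) * second_moment \<nu> L)
      = (\<integral>x. \<xi>\<^sup>2 / 4 * (x\<^sup>2 * exp (- (2 * L) * x) - exp (- A) * (x\<^sup>2 * exp (- L * x))) \<partial>\<nu>)"
    unfolding second_moment_def integral_mult_right_zero
      Bochner_Integration.integral_diff[OF int(2) integrable_mult_right[OF int(1)]] ..
  also have "\<dots> \<le> (\<integral>x. - Re (?k x) \<partial>\<nu>)"
  proof (rule integral_mono)
    show "integrable \<nu> (\<lambda>x. \<xi>\<^sup>2 / 4 * (x\<^sup>2 * exp (- (2 * L) * x) - exp (- A) * (x\<^sup>2 * exp (- L * x))))"
      by (intro integrable_mult_right Bochner_Integration.integrable_diff int)
    show "integrable \<nu> (\<lambda>x. - Re (?k x))"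
      by (intro Bochner_Integration.integrable_minus integrable_Re int_k)
    fix x assume "x \<in> space \<nu>"
    then have x: "0 < x" by (simp add: space_levy_measure[OF levy_measure])
    have k: "- Re (?k x) = exp (- w * x) * (1 - cos (\<xi> * x))"
      by (simp add: Re_exp algebra_simps)
    show "\<xi>\<^sup>2 / 4 * (x\<^sup>2 * exp (- (2 * L) * x) - exp (- A) * (x\<^sup>2 * exp (- L * x))) \<le> - Re (?k x)"
    proof (cases "\<bar>\<xi> * x\<bar> \<le> 1")
      case True
      have "w * x \<le> 2 * L * x" using L x w by (intro mult_right_mono) auto
      then have "exp (- (2 * L) * x) \<le> exp (- w * x)" by simp
      then have "exp (- (2 * L) * x) * ((\<xi> * x)\<^sup>2 / 4) \<le> exp (- w * x) * (1 - cos (\<xi> * x))"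
        by (rule mult_mono[OF _ one_minus_cos_ge[OF True]]) simp_all
      moreover have "\<xi>\<^sup>2 / 4 * (x\<^sup>2 * exp (- (2 * L) * x)) = exp (- (2 * L) * x) * ((\<xi> * x)\<^sup>2 / 4)"
        by (simp only: power_mult_distrib times_divide_eq_left times_divide_eq_right mult_ac)
      moreover have "\<xi>\<^sup>2 / 4 * (x\<^sup>2 * exp (- (2 * L) * x) - exp (- A) * (x\<^sup>2 * exp (- L * x)))
          \<le> \<xi>\<^sup>2 / 4 * (x\<^sup>2 * exp (- (2 * L) * x))"
        by (intro mult_left_mono) simp_all
      ultimately show ?thesis unfolding k by linarith
    next
      case False
      have "A * 1 \<le> A * \<bar>\<xi> * x\<bar>" using False A by (intro mult_left_mono) auto
      also have "\<dots> \<le> L * x"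
        using x w unfolding L_def by (simp add: abs_mult algebra_simps)
      finally have "exp (- (2 * L) * x) \<le> exp (- A) * exp (- L * x)"
        by (simp add: exp_add[symmetric])
      then have "x\<^sup>2 * exp (- (2 * L) * x) \<le> x\<^sup>2 * (exp (- A) * exp (- L * x))"
        by (rule mult_left_mono) simp
      then have "x\<^sup>2 * exp (- (2 * L) * x) - exp (- A) * (x\<^sup>2 * exp (- L * x)) \<le> 0"
        by (simp only: mult.left_commute[of "exp (- A)"] diff_le_0_iff_le)
      then have "\<xi>\<^sup>2 / 4 * (x\<^sup>2 * exp (- (2 * L) * x) - exp (- A) * (x\<^sup>2 * exp (- L * x))) \<le> 0"
        by (intro mult_nonneg_nonpos) simp_all
      also have "0 \<le> - Re (?k x)" unfolding k by simp
      finally show ?thesis .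
    qed
  qed
  also have "\<dots> = - Re (\<integral>x. ?k x \<partial>\<nu>)"
    by (simp only: Bochner_Integration.integral_minus integral_Re[OF int_k])
  finally have "\<xi>\<^sup>2 / 4 * (second_moment \<nu> (2 * L) - exp (- A) * second_moment \<nu> L) \<le> - Re (\<integral>x. ?k x \<partial>\<nu>)" .
  moreover have "\<phi> w - Re (complex_exponent \<sigma> b \<nu> (of_real w - \<i> * of_real \<xi>)) = \<sigma>\<^sup>2 * \<xi>\<^sup>2 - Re (\<integral>x. ?k x \<partial>\<nu>)"
    unfolding complex_exponent_vertical_line(2)[OF w] minus_complex.sel plus_complex.sel by simp
  moreover have "\<xi>\<^sup>2 / 4 * (2 * \<sigma>\<^sup>2 - exp (- A) * (2 * \<sigma>\<^sup>2)) \<le> \<xi>\<^sup>2 / 4 * (4 * \<sigma>\<^sup>2)"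
  proof (rule mult_left_mono)
    have "0 \<le> exp (- A) * (2 * \<sigma>\<^sup>2)" "0 \<le> \<sigma>\<^sup>2" by simp_all
    then show "2 * \<sigma>\<^sup>2 - exp (- A) * (2 * \<sigma>\<^sup>2) \<le> 4 * \<sigma>\<^sup>2" by linarith
  qed simp
  moreover have "\<xi>\<^sup>2 / 4 * (deriv (deriv \<phi>) (2 * L) - exp (- A) * deriv (deriv \<phi>) L)
      = \<xi>\<^sup>2 / 4 * (second_moment \<nu> (2 * L) - exp (- A) * second_moment \<nu> L) + \<xi>\<^sup>2 / 4 * (2 * \<sigma>\<^sup>2 - exp (- A) * (2 * \<sigma>\<^sup>2))"
    using L by (simp only: deriv_deriv_exponent mult_pos_pos zero_less_numeral) (simp add: algebra_simps)
  moreover have "\<xi>\<^sup>2 / 4 * (4 * \<sigma>\<^sup>2) = \<sigma>\<^sup>2 * \<xi>\<^sup>2" by simp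
  ultimately show ?thesis
    by linarith
qed

end

section \<open>Consequences of weak lower scaling\<close>

text \<open>
  This lets one assume \<open>\<alpha> \<le> 2\<close>, where \<open>r \<mapsto> r powr (\<alpha> - 2)\<close> is nonincreasing.
\<close>

lemma WLSC_antimono_exponent:
  assumes "f \<in> WLSC \<beta> c x0" "\<gamma> \<le> \<beta>" "0 \<le> c" "0 \<le> x0"
  shows "f \<in> WLSC \<gamma> c x0"
  unfolding WLSC_def
proof (intro CollectI conjI allI impI)
  fix r x :: real assume r: "1 \<le> r" and x: "x0 < x"
  have "0 \<le> f x" using assms x by (auto simp: WLSC_def)
  moreover have "r powr \<gamma> \<le> r powr \<beta>" using r assms by (intro powr_mono) auto
  ultimately have "c * r powr \<gamma> * f x \<le> c * r powr \<beta> * f x"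
    using assms by (intro mult_right_mono mult_left_mono) auto
  also have "\<dots> \<le> f (r * x)" using assms r x by (auto simp: WLSC_def)
  finally show "c * r powr \<gamma> * f x \<le> f (r * x)" .
qed (use assms in \<open>auto simp: WLSC_def\<close>)

context
  fixes \<phi> :: "real \<Rightarrow> real" and \<sigma> b :: real and \<nu> :: "real measure"
  assumes LK: "levy_khintchine \<phi> \<sigma> b \<nu>"
begin

text \<open>
  Without a Gaussian part \<open>\<phi>'' w = 0\<close> would force \<open>\<nu> = 0\<close>, contradicting unbounded variation.
\<close>

lemma deriv_deriv_exponent_pos:
  assumes "unbounded_variation \<sigma> \<nu>" "0 < w"
  shows "0 < deriv (deriv \<phi>) w"
proof (cases "0 < \<sigma>")
  case True
  then show ?thesis
    using second_moment_nonneg[OF LK, of w] by (simp add: deriv_deriv_exponent[OF LK assms(2)] add_pos_nonneg)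
next
  case False
  with assms(1) have inf: "(\<integral>\<^sup>+x\<in>{0<..<1}. ennreal x \<partial>\<nu>) = \<infinity>"
    by (simp add: unbounded_variation_def)
  have "second_moment \<nu> w \<noteq> 0"
  proof
    assume "second_moment \<nu> w = 0"
    then have "AE x in \<nu>. x\<^sup>2 * exp (- w * x) = 0"
      unfolding second_moment_def
      by (subst (asm) integral_nonneg_eq_0_iff_AE[OF integrable_second_moment[OF levy_measure[OF LK] assms(2)]]) simp_all
    then have "AE x in \<nu>. ennreal x * indicator {0<..<1} x = 0"
      by eventually_elim simp
    then have "(\<integral>\<^sup>+x\<in>{0<..<1}. ennreal x \<partial>\<nu>) = (\<integral>\<^sup>+x. 0 \<partial>\<nu>)"
      by (rule nn_integral_cong_AE)
    with inf show False by simp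
  qed
  moreover have "0 \<le> second_moment \<nu> w" by (rule second_moment_nonneg[OF LK])
  ultimately show ?thesis
    by (simp add: deriv_deriv_exponent[OF LK assms(2)] add_nonneg_pos)
qed

context
  fixes \<beta> c x0 :: real
  assumes scaling: "deriv (deriv \<phi>) \<in> WLSC \<beta> c x0" and c: "0 < c" and x0: "0 \<le> x0"
begin

lemma deriv_deriv_exponent_scaling:
  "1 \<le> r \<Longrightarrow> x0 < x \<Longrightarrow> c * r powr \<beta> * deriv (deriv \<phi>) x \<le> deriv (deriv \<phi>) (r * x)"
  using scaling by (simp add: WLSC_def)

lemma deriv_deriv_exponent_nonneg:
  "0 < w \<Longrightarrow> 0 \<le> deriv (deriv \<phi>) w"
  using scaling by (simp add: WLSC_def)

text \<open>
  Scaling from \<open>L\<close> to \<open>2 L\<close> gives \<open>\<phi>'' (2 L) \<ge> a \<phi>'' L\<close>, and \<open>A\<close> is chosen so large that the term subtracted in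
  \<open>Re_complex_exponent_decay\<close> is at most half of this. Scaling from \<open>w\<close> to \<open>L = (1 + A \<bar>\<xi>\<bar> / w) w\<close> then
  compares with \<open>\<phi>'' w\<close>. Both \<open>w\<close> and \<open>L\<close> exceed \<open>x0\<close>, so \<open>k\<close> and \<open>A\<close> do not depend on \<open>w\<close>.
\<close>

lemma Re_complex_exponent_scaling_decay:
  obtains k A where "0 < k" "0 \<le> A"
    "\<And>w \<xi>. x0 < w \<Longrightarrow> k * (\<xi>\<^sup>2 * deriv (deriv \<phi>) w) * (1 + A * \<bar>\<xi>\<bar> / w) powr \<beta>
      \<le> \<phi> w - Re (complex_exponent \<sigma> b \<nu> (of_real w - \<i> * of_real \<xi>))"
proof
  \<comment> \<open>With this \<open>A\<close> one has \<open>exp (- A) \<le> a / 2\<close> and \<open>A \<ge> 0\<close>.\<close>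
  define a where "a = c * 2 powr \<beta>"
  define A where "A = max 0 (ln (2 / a))"
  have a: "0 < a" using c by (simp add: a_def)
  show A: "0 \<le> A" by (simp add: A_def)
  show "0 < a * c / 8" using a c by simp
  have "exp (- A) \<le> exp (- ln (2 / a))" by (simp add: A_def)
  also have "\<dots> = a / 2" using a by (simp add: exp_minus)
  finally have expA: "exp (- A) \<le> a / 2" .
  fix w \<xi> :: real assume w: "x0 < w"
  with x0 have w0: "0 < w" by simp
  define L where "L = w + A * \<bar>\<xi>\<bar>"
  have "0 \<le> A * \<bar>\<xi>\<bar>" using A by simp
  then have L: "x0 < L" "0 < L" unfolding L_def using w w0 by linarith+
  have Lw: "L = (1 + A * \<bar>\<xi>\<bar> / w) * w" unfolding L_def using w0 by (simp add: field_simps)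
  have "c * (1 + A * \<bar>\<xi>\<bar> / w) powr \<beta> * deriv (deriv \<phi>) w \<le> deriv (deriv \<phi>) L"
    unfolding Lw using A w0 w by (intro deriv_deriv_exponent_scaling) auto
  then have "a / 2 * (c * (1 + A * \<bar>\<xi>\<bar> / w) powr \<beta> * deriv (deriv \<phi>) w) \<le> a / 2 * deriv (deriv \<phi>) L"
    using a by (intro mult_left_mono) auto
  also have "\<dots> = a * deriv (deriv \<phi>) L - a / 2 * deriv (deriv \<phi>) L" by (simp add: field_simps)
  also have "\<dots> \<le> deriv (deriv \<phi>) (2 * L) - exp (- A) * deriv (deriv \<phi>) L"
    using deriv_deriv_exponent_scaling[of 2 L] L expA
    by (intro diff_mono mult_right_mono deriv_deriv_exponent_nonneg) (simp_all add: a_def)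
  finally have "\<xi>\<^sup>2 / 4 * (a / 2 * (c * (1 + A * \<bar>\<xi>\<bar> / w) powr \<beta> * deriv (deriv \<phi>) w))
      \<le> \<xi>\<^sup>2 / 4 * (deriv (deriv \<phi>) (2 * L) - exp (- A) * deriv (deriv \<phi>) L)"
    by (rule mult_left_mono) simp
  also have "\<dots> \<le> \<phi> w - Re (complex_exponent \<sigma> b \<nu> (of_real w - \<i> * of_real \<xi>))"
    unfolding L_def by (rule Re_complex_exponent_decay[OF LK w0 A])
  finally show "a * c / 8 * (\<xi>\<^sup>2 * deriv (deriv \<phi>) w) * (1 + A * \<bar>\<xi>\<bar> / w) powr \<beta>
      \<le> \<phi> w - Re (complex_exponent \<sigma> b \<nu> (of_real w - \<i> * of_real \<xi>))"
    by (simp add: mult_ac)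
qed

text \<open>
  For \<open>w > 2 x0\<close> this is scaling from \<open>w / 2\<close> to \<open>w\<close>. The scaling condition says nothing at \<open>w / 2\<close> when
  \<open>x0 < w \<le> 2 x0\<close>; there monotonicity and positivity of \<open>\<phi>''\<close> suffice. Here the constant depends on \<open>\<phi>\<close> and
  not only on the scaling parameters.
\<close>

lemma deriv_deriv_exponent_doubling:
  assumes "unbounded_variation \<sigma> \<nu>"
  obtains D where "0 < D" "\<And>w. x0 < w \<Longrightarrow> deriv (deriv \<phi>) (w / 2) \<le> D * deriv (deriv \<phi>) w"
proof
  let ?f = "deriv (deriv \<phi>)"
  note pos = deriv_deriv_exponent_pos[OF assms]
  \<comment> \<open>The two entries serve \<open>2 * x0 < w\<close> and \<open>x0 < w \<le> 2 * x0\<close>.\<close>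
  define D where "D = max (1 / (c * 2 powr \<beta>)) (?f (x0 / 2) / ?f (2 * x0))"
  have D1: "1 / (c * 2 powr \<beta>) \<le> D" and D2: "?f (x0 / 2) / ?f (2 * x0) \<le> D" by (simp_all add: D_def)
  show "0 < D" using c by (intro less_le_trans[OF _ D1]) simp
  fix w assume w: "x0 < w"
  with x0 have w0: "0 < w" by simp
  show "?f (w / 2) \<le> D * ?f w"
  proof (cases "x0 < w / 2")
    case True
    have "c * 2 powr \<beta> * ?f (w / 2) \<le> ?f w"
      using deriv_deriv_exponent_scaling[of 2 "w / 2"] True by simp
    then have "?f (w / 2) \<le> 1 / (c * 2 powr \<beta>) * ?f w"
      using c by (simp add: field_simps)
    also have "\<dots> \<le> D * ?f w"
      using D1 pos[OF w0] by (intro mult_right_mono) auto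
    finally show ?thesis .
  next
    case False
    with w x0 have x0': "0 < x0" by linarith
    have anti: "?f v \<le> ?f u" if "0 < u" "u \<le> v" for u v
      using that second_moment_antimono[OF LK that] by (simp add: deriv_deriv_exponent[OF LK])
    have "?f (w / 2) \<le> ?f (x0 / 2)" using w x0' by (intro anti) auto
    also have "\<dots> = ?f (x0 / 2) / ?f (2 * x0) * ?f (2 * x0)"
      using pos[of "2 * x0"] x0' by simp
    also have "\<dots> \<le> D * ?f w"
    proof (rule mult_mono[OF D2])
      show "?f (2 * x0) \<le> ?f w" using False w0 by (intro anti) auto
      show "0 \<le> D" using \<open>0 < D\<close> by simp
      show "0 \<le> ?f (2 * x0)" using pos[of "2 * x0"] x0' by simp
    qed
    finally show ?thesis .
  qed
qed

end
end

section \<open>Integrals close to the Gaussian integral\<close>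

text \<open>
  For large \<open>\<bar>u\<bar>\<close> the exponent is at least of order \<open>\<bar>u\<bar> powr \<alpha>\<close>, so the function decays faster than \<open>1 / (1 + u\<^sup>2)\<close>.
\<close>

lemma integrable_stretched_gaussian:
  fixes k A \<alpha> :: real
  assumes k: "0 < k" and A: "0 \<le> A" and \<alpha>: "0 < \<alpha>" "\<alpha> \<le> 2"
  shows "integrable lborel (\<lambda>u. exp (- (k * u\<^sup>2 * (1 + A * \<bar>u\<bar>) powr (\<alpha> - 2))))"
proof -
  define \<kappa> where "\<kappa> = k * (1 + A) powr (\<alpha> - 2)"
  have \<kappa>: "0 < \<kappa>" using k A by (simp add: \<kappa>_def)
  have "((\<lambda>u. (1 + u\<^sup>2) * exp (- (\<kappa> * u powr \<alpha>))) \<longlongrightarrow> 0) at_top"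
    using \<kappa> \<alpha>(1) by real_asymp
  then have "eventually (\<lambda>u. (1 + u\<^sup>2) * exp (- (\<kappa> * u powr \<alpha>)) < 1) at_top"
    by (rule order_tendstoD) simp
  then obtain U0 where U0: "\<And>u. u \<ge> U0 \<Longrightarrow> (1 + u\<^sup>2) * exp (- (\<kappa> * u powr \<alpha>)) < 1"
    by (auto simp: eventually_at_top_linorder)
  \<comment> \<open>\<open>1 \<le> U\<close> is what makes \<open>1 + A * \<bar>u\<bar> \<le> (1 + A) * \<bar>u\<bar>\<close> available in the tail.\<close>
  define U where "U = max 1 U0"
  have bound: "exp (- (k * u\<^sup>2 * (1 + A * \<bar>u\<bar>) powr (\<alpha> - 2))) \<le> (1 + U\<^sup>2) * inverse (1 + u\<^sup>2)" for u
  proof (cases "\<bar>u\<bar> \<ge> U")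
    case True
    then have u: "\<bar>u\<bar> \<ge> 1" "\<bar>u\<bar> \<ge> U0" by (auto simp: U_def)
    have "\<kappa> * \<bar>u\<bar> powr \<alpha> = k * u\<^sup>2 * ((1 + A) * \<bar>u\<bar>) powr (\<alpha> - 2)"
    proof -
      have "\<bar>u\<bar> powr \<alpha> = \<bar>u\<bar> powr (2 + (\<alpha> - 2))" by simp
      also have "\<dots> = \<bar>u\<bar> powr 2 * \<bar>u\<bar> powr (\<alpha> - 2)" by (rule powr_add)
      also have "\<bar>u\<bar> powr 2 = u\<^sup>2" using u by (simp add: powr_numeral)
      finally show ?thesis using A by (simp add: \<kappa>_def powr_mult)
    qed
    also have "\<dots> \<le> k * u\<^sup>2 * (1 + A * \<bar>u\<bar>) powr (\<alpha> - 2)"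
      using u A k \<alpha> by (intro mult_left_mono powr_mono2') (auto simp: algebra_simps add_pos_nonneg)
    finally have "exp (- (k * u\<^sup>2 * (1 + A * \<bar>u\<bar>) powr (\<alpha> - 2))) \<le> exp (- (\<kappa> * \<bar>u\<bar> powr \<alpha>))"
      by simp
    also have "\<dots> \<le> inverse (1 + u\<^sup>2)"
    proof -
      have "0 < 1 + u\<^sup>2" by (simp add: add_pos_nonneg)
      then show ?thesis
        using U0[OF u(2)] by (simp add: field_simps)
    qed
    also have "\<dots> = 1 * inverse (1 + u\<^sup>2)" by simp
    also have "\<dots> \<le> (1 + U\<^sup>2) * inverse (1 + u\<^sup>2)"
      by (rule mult_right_mono) simp_all
    finally show ?thesis .
  next
    case False
    then have "\<bar>u\<bar>\<^sup>2 \<le> U\<^sup>2" by (intro power_mono) auto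
    moreover have pos: "0 < 1 + u\<^sup>2" by (simp add: add_pos_nonneg)
    ultimately have "1 \<le> (1 + U\<^sup>2) * inverse (1 + u\<^sup>2)"
      by (simp add: field_simps)
    moreover have "exp (- (k * u\<^sup>2 * (1 + A * \<bar>u\<bar>) powr (\<alpha> - 2))) \<le> 1"
      using k by simp
    ultimately show ?thesis by linarith
  qed
  have "integrable lborel (\<lambda>u. (1 + U\<^sup>2) * inverse (1 + u\<^sup>2))"
    using integrable_inverse_1_plus_square
    by (intro integrable_mult_right) (simp add: set_integrable_def)
  then show ?thesis
    by (rule Bochner_Integration.integrable_bound) (use bound in \<open>auto intro: order_trans[OF bound]\<close>)
qed

lemma integral_gaussian: "integrable lborel (\<lambda>u::real. exp (- u\<^sup>2 / 2))"
    "(\<integral>u. exp (- u\<^sup>2 / 2) \<partial>lborel) = sqrt (2 * pi)"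
proof -
  have eq: "exp (- u\<^sup>2 / 2) = sqrt (2 * pi) * std_normal_density u" for u
    by (simp add: std_normal_density_def)
  show "integrable lborel (\<lambda>u::real. exp (- u\<^sup>2 / 2))"
    unfolding eq by (intro integrable_mult_right integrable_normal_density) simp
  show "(\<integral>u. exp (- u\<^sup>2 / 2) \<partial>lborel) = sqrt (2 * pi)"
    unfolding eq integral_mult_right_zero by (subst integral_normal_density) simp_all
qed

text \<open>
  Since \<open>exp\<close> is a contraction on the left half-plane, \<open>exp (E u)\<close> differs from \<open>exp (- u\<^sup>2 / 2)\<close> by at most the
  minimum of \<open>C \<bar>u\<bar>\<^sup>3 / sqrt T\<close> and of an integrable function that works for all \<open>T \<ge> 1\<close>. This minimum does not
  depend on \<open>E\<close>, decreases in \<open>T\<close>, and its integral tends to \<open>0\<close> by dominated convergence; hence \<open>M0\<close>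
  is uniform in \<open>E\<close>.
\<close>

lemma integral_near_gaussian:
  fixes k A \<alpha> C \<epsilon> :: real
  assumes k: "0 < k" and A: "0 \<le> A" and \<alpha>: "0 < \<alpha>" "\<alpha> \<le> 2" and C: "0 \<le> C" and \<epsilon>: "0 < \<epsilon>"
  obtains M0 where "0 < M0"
    "\<And>T E. M0 < T \<Longrightarrow> (\<lambda>u. exp (E u)) \<in> borel_measurable borel \<Longrightarrow>
      (\<And>u. norm (E u + of_real (u\<^sup>2 / 2)) \<le> C * \<bar>u\<bar>^3 / sqrt T) \<Longrightarrow>
      (\<And>u. Re (E u) \<le> - (k * u\<^sup>2 * (1 + A * \<bar>u\<bar> / sqrt T) powr (\<alpha> - 2))) \<Longrightarrow>
      \<bar>Re (\<integral>u. exp (E u) \<partial>lborel) / sqrt (2 * pi) - 1\<bar> \<le> \<epsilon>"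
proof -
  define g where "g = (\<lambda>u::real. exp (- (k * u\<^sup>2 * (1 + A * \<bar>u\<bar>) powr (\<alpha> - 2))))"
  define h where "h = (\<lambda>n u. min (C * \<bar>u\<bar>^3 / sqrt (real n)) (g u + exp (- u\<^sup>2 / 2)))"
  have int_g: "integrable lborel g"
    unfolding g_def by (rule integrable_stretched_gaussian[OF k A \<alpha>])
  have [measurable]: "g \<in> borel_measurable borel" unfolding g_def by measurable
  have [measurable]: "h n \<in> borel_measurable borel" for n unfolding h_def by measurable
  have int_sum: "integrable lborel (\<lambda>u. g u + exp (- u\<^sup>2 / 2))"
    by (intro Bochner_Integration.integrable_add int_g integral_gaussian(1))
  have h_bounds: "0 \<le> h n u" "h n u \<le> g u + exp (- u\<^sup>2 / 2)" for n u
    using C by (auto simp: h_def g_def min_def)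
  have int_h: "integrable lborel (h n)" for n
  proof (rule Bochner_Integration.integrable_bound[OF int_sum])
    show "AE u in lborel. norm (h n u) \<le> norm (g u + exp (- u\<^sup>2 / 2))"
      using h_bounds by (intro AE_I2) (metis abs_ge_self abs_of_nonneg order_trans real_norm_def)
  qed simp
  have "(\<lambda>n. \<integral>u. h n u \<partial>lborel) \<longlonglongrightarrow> (\<integral>u. 0 \<partial>(lborel :: real measure))"
  proof (rule integral_dominated_convergence[where f="\<lambda>_. 0" and s=h, OF _ _ int_sum])
    show "AE u in lborel. (\<lambda>n. h n u) \<longlonglongrightarrow> 0"
    proof (rule AE_I2)
      fix u :: real
      have lim: "(\<lambda>n. C * \<bar>u\<bar>^3 / sqrt (real n)) \<longlonglongrightarrow> 0"
        by real_asymp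
      show "(\<lambda>n. h n u) \<longlonglongrightarrow> 0"
      proof (rule tendsto_sandwich[OF _ _ tendsto_const lim])
        show "eventually (\<lambda>n. 0 \<le> h n u) sequentially" by (simp add: h_bounds)
        show "eventually (\<lambda>n. h n u \<le> C * \<bar>u\<bar>^3 / sqrt (real n)) sequentially" by (simp add: h_def)
      qed
    qed
    show "AE u in lborel. norm (h n u) \<le> g u + exp (- u\<^sup>2 / 2)" for n
      by (intro AE_I2) (metis abs_of_nonneg h_bounds real_norm_def)
  qed simp_all
  then have "(\<lambda>n. \<integral>u. h n u \<partial>lborel) \<longlonglongrightarrow> 0" by simp
  then have "eventually (\<lambda>n. (\<integral>u. h n u \<partial>lborel) < \<epsilon> * sqrt (2 * pi)) sequentially"
    by (rule order_tendstoD(2)) (use \<epsilon> in \<open>simp add: zero_less_mult_iff\<close>)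
  then have "eventually (\<lambda>n. (\<integral>u. h n u \<partial>lborel) < \<epsilon> * sqrt (2 * pi) \<and> 1 \<le> n) sequentially"
    using eventually_ge_at_top by (rule eventually_conj)
  then obtain n where n: "(\<integral>u. h n u \<partial>lborel) < \<epsilon> * sqrt (2 * pi)" "1 \<le> n"
    by (auto simp: eventually_sequentially)
  show ?thesis
  proof (rule that[of "real n"])
    show "0 < real n" using n by simp
    fix T and E :: "real \<Rightarrow> complex"
    assume T: "real n < T" and meas[measurable]: "(\<lambda>u. exp (E u)) \<in> borel_measurable borel"
      and E1: "\<And>u. norm (E u + of_real (u\<^sup>2 / 2)) \<le> C * \<bar>u\<bar>^3 / sqrt T"
      and E2: "\<And>u. Re (E u) \<le> - (k * u\<^sup>2 * (1 + A * \<bar>u\<bar> / sqrt T) powr (\<alpha> - 2))"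
    have T1: "1 \<le> sqrt T" "sqrt (real n) \<le> sqrt T" "0 < sqrt (real n)" using T n by auto
    have neg: "Re (E u) \<le> - (k * u\<^sup>2 * (1 + A * \<bar>u\<bar>) powr (\<alpha> - 2))" for u
    proof (rule order_trans[OF E2])
      have "A * \<bar>u\<bar> / sqrt T \<le> A * \<bar>u\<bar> / 1"
        using T1 A by (intro divide_left_mono) auto
      then have "(1 + A * \<bar>u\<bar>) powr (\<alpha> - 2) \<le> (1 + A * \<bar>u\<bar> / sqrt T) powr (\<alpha> - 2)"
        using \<alpha> A T1 by (intro powr_mono2') (auto intro!: add_pos_nonneg divide_nonneg_nonneg)
      then have "k * u\<^sup>2 * (1 + A * \<bar>u\<bar>) powr (\<alpha> - 2) \<le> k * u\<^sup>2 * (1 + A * \<bar>u\<bar> / sqrt T) powr (\<alpha> - 2)"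
        using k by (intro mult_left_mono) auto
      then show "- (k * u\<^sup>2 * (1 + A * \<bar>u\<bar> / sqrt T) powr (\<alpha> - 2)) \<le> - (k * u\<^sup>2 * (1 + A * \<bar>u\<bar>) powr (\<alpha> - 2))"
        by simp
    qed
    have normE: "norm (exp (E u)) \<le> g u" for u
      using neg[of u] by (simp add: norm_exp_eq_Re g_def)
    have ReE: "Re (E u) \<le> 0" for u
      by (rule order_trans[OF neg]) (use k in simp)
    have int_E: "integrable lborel (\<lambda>u. exp (E u))"
      by (rule Bochner_Integration.integrable_bound[OF int_g]) (use normE in \<open>auto simp: g_def\<close>)
    have int_G: "integrable lborel (\<lambda>u. complex_of_real (exp (- u\<^sup>2 / 2)))"
      by (intro integrable_of_real integral_gaussian(1))
    have diff: "norm (exp (E u) - complex_of_real (exp (- u\<^sup>2 / 2))) \<le> h n u" for u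
    proof -
      have "norm (exp (E u) - exp (complex_of_real (- u\<^sup>2 / 2))) \<le> norm (E u - complex_of_real (- u\<^sup>2 / 2))"
        by (rule norm_exp_diff_le) (use ReE in simp_all)
      also have "\<dots> = norm (E u + of_real (u\<^sup>2 / 2))" by simp
      also have "\<dots> \<le> C * \<bar>u\<bar>^3 / sqrt T" by (rule E1)
      also have "\<dots> \<le> C * \<bar>u\<bar>^3 / sqrt (real n)"
        using T1 C by (intro divide_left_mono) auto
      finally have 1: "norm (exp (E u) - complex_of_real (exp (- u\<^sup>2 / 2))) \<le> C * \<bar>u\<bar>^3 / sqrt (real n)"
        by (simp only: exp_of_real)
      have "norm (exp (E u) - complex_of_real (exp (- u\<^sup>2 / 2))) \<le> norm (exp (E u)) + norm (complex_of_real (exp (- u\<^sup>2 / 2)))"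
        by (rule norm_triangle_ineq4)
      also have "\<dots> \<le> g u + exp (- u\<^sup>2 / 2)"
        using normE[of u] by simp
      finally show ?thesis using 1 by (simp add: h_def)
    qed
    have "(\<integral>u. exp (E u) \<partial>lborel) - of_real (sqrt (2 * pi)) = (\<integral>u. exp (E u) - complex_of_real (exp (- u\<^sup>2 / 2)) \<partial>lborel)"
      by (simp only: Bochner_Integration.integral_diff[OF int_E int_G] integral_complex_of_real integral_gaussian(2))
    moreover have "norm (\<integral>u. exp (E u) - complex_of_real (exp (- u\<^sup>2 / 2)) \<partial>lborel) \<le> (\<integral>u. h n u \<partial>lborel)"
      by (rule Bochner_Integration.integral_norm_bound_integral[OF Bochner_Integration.integrable_diff[OF int_E int_G] int_h diff])
    ultimately have "norm ((\<integral>u. exp (E u) \<partial>lborel) - of_real (sqrt (2 * pi))) \<le> \<epsilon> * sqrt (2 * pi)"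
      using n(1) by simp
    with abs_Re_le_cmod[of "(\<integral>u. exp (E u) \<partial>lborel) - of_real (sqrt (2 * pi))"]
    have "\<bar>Re (\<integral>u. exp (E u) \<partial>lborel) - sqrt (2 * pi)\<bar> \<le> \<epsilon> * sqrt (2 * pi)"
      by simp
    then have "\<bar>Re (\<integral>u. exp (E u) \<partial>lborel) - sqrt (2 * pi)\<bar> / sqrt (2 * pi) \<le> \<epsilon>"
      by (simp add: pos_divide_le_eq)
    moreover have "Re (\<integral>u. exp (E u) \<partial>lborel) / sqrt (2 * pi) - 1 = (Re (\<integral>u. exp (E u) \<partial>lborel) - sqrt (2 * pi)) / sqrt (2 * pi)"
      by (simp add: diff_divide_distrib)
    ultimately show "\<bar>Re (\<integral>u. exp (E u) \<partial>lborel) / sqrt (2 * pi) - 1\<bar> \<le> \<epsilon>"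
      by (simp only: abs_divide) simp
  qed
qed

section \<open>Exponential tilting\<close>

lemma continuous_density_unique:
  assumes p: "continuous_density M Y p" and q: "continuous_density M Y q"
  shows "p = q"
proof
  fix x
  have cont: "continuous_on UNIV p" "continuous_on UNIV q" and nn: "\<And>x. 0 \<le> p x" "\<And>x. 0 \<le> q x"
    using p q by (auto simp: continuous_density_def)
  note [measurable] = borel_measurable_continuous_onI[OF cont(1)] borel_measurable_continuous_onI[OF cont(2)]
  have "density lborel (\<lambda>x. ennreal (p x)) = density lborel (\<lambda>x. ennreal (q x))"
    using p q by (simp add: continuous_density_def distributed_def)
  then have "AE x in lborel. ennreal (p x) = ennreal (q x)"
    by (intro sigma_finite_measure.density_unique[OF sigma_finite_lborel]) simp_all
  then have "AE x in lborel. x \<in> {x. p x = q x}"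
    by eventually_elim (use nn in simp)
  then have "AE x in lebesgue. x \<in> {x. p x = q x}"
    by (rule AE_completion)
  moreover have "closed {x. p x = q x}"
    by (rule closed_Collect_eq[OF cont])
  ultimately have "x \<in> {x. p x = q x}"
    by (intro mem_closed_if_AE_lebesgue)
  then show "p x = q x" by simp
qed

text \<open>
  The characteristic function of the law of \<open>X t\<close> tilted by \<open>exp (- w x - t \<phi> w)\<close>.
\<close>

definition tilted_char :: "(real \<Rightarrow> real) \<Rightarrow> real \<Rightarrow> real \<Rightarrow> real measure \<Rightarrow> real \<Rightarrow> real \<Rightarrow> real \<Rightarrow> complex" where
  "tilted_char \<phi> \<sigma> b \<nu> t w \<xi> =
    exp (of_real t * (complex_exponent \<sigma> b \<nu> (of_real w - \<i> * of_real \<xi>) - of_real (\<phi> w)))"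

context
  fixes \<phi> :: "real \<Rightarrow> real" and \<sigma> b :: real and \<nu> :: "real measure"
    and N :: "real measure" and t :: real
  assumes LK: "levy_khintchine \<phi> \<sigma> b \<nu>"
    and N: "sets N = sets borel"
    and laplace: "\<And>u. 0 \<le> u \<Longrightarrow> has_bochner_integral N (\<lambda>x. exp (- u * x)) (exp (t * \<phi> u))"
begin

text \<open>
  Both sides are holomorphic on the right half-plane and agree on the positive reals.
\<close>

lemma laplace_transform_eq_complex_exponent:
  assumes z: "0 < Re z"
  shows "(\<integral>x. exp (- z * of_real x) \<partial>N) = exp (of_real t * complex_exponent \<sigma> b \<nu> z)"
proof -
  let ?S = "{z. 0 < Re z}" and ?U = "complex_of_real ` {0<..}"
  let ?L = "\<lambda>z. \<integral>x. exp (- z * complex_of_real x) \<partial>N"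
  have int: "integrable N (\<lambda>x. exp (- u * x))" if "0 < u" for u :: real
    using laplace[of u] that by (simp add: has_bochner_integral_iff)
  have "?L z - exp (of_real t * complex_exponent \<sigma> b \<nu> z) = 0"
  proof (rule analytic_continuation[where S="?S" and U="?U" and \<xi>=1
        and f="\<lambda>z. ?L z - exp (of_real t * complex_exponent \<sigma> b \<nu> z)"])
    have "complex_exponent \<sigma> b \<nu> holomorphic_on ?S"
      unfolding holomorphic_on_def field_differentiable_def
      using complex_exponent_has_field_derivative[OF LK] has_field_derivative_at_within by blast
    then show "(\<lambda>z. ?L z - exp (of_real t * complex_exponent \<sigma> b \<nu> z)) holomorphic_on ?S"
      by (intro holomorphic_on_diff laplace_transform_holomorphic[OF N int] holomorphic_on_exp'
          holomorphic_on_mult holomorphic_on_const)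
    show "open ?S" by (rule open_halfspace_Re_gt)
    show "connected ?S" by (intro convex_connected convex_halfspace_Re_gt)
    show "?U \<subseteq> ?S" by auto
    show "(1::complex) islimpt ?U"
      unfolding islimpt_approachable
    proof (intro allI impI)
      fix e :: real assume "0 < e"
      then have "complex_of_real (1 + e / 2) \<in> ?U" by (intro imageI) simp
      with \<open>0 < e\<close> show "\<exists>y\<in>?U. y \<noteq> 1 \<and> dist y 1 < e"
        by (intro bexI[of _ "complex_of_real (1 + e / 2)"]) (simp_all add: dist_norm)
    qed
    fix y assume "y \<in> ?U"
    then obtain u where u: "0 < u" "y = of_real u" by auto
    have "?L y = (\<integral>x. complex_of_real (exp (- u * x)) \<partial>N)"
      by (intro Bochner_Integration.integral_cong refl) (simp add: u exp_of_real[symmetric])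
    also have "\<dots> = of_real (exp (t * \<phi> u))"
      using has_bochner_integral_integral_eq[OF laplace[of u]] u
      by (simp only: integral_complex_of_real)
    finally show "?L y - exp (of_real t * complex_exponent \<sigma> b \<nu> y) = 0"
      using u by (simp add: complex_exponent_of_real[OF LK] exp_of_real[symmetric])
  qed (use z in simp_all)
  then show ?thesis by simp
qed

lemma exponentially_tilted_law:
  assumes w: "0 < w"
  defines "Q \<equiv> density N (\<lambda>x. ennreal (exp (- w * x - t * \<phi> w)))"
  shows "real_distribution Q" "char Q = tilted_char \<phi> \<sigma> b \<nu> t w"
proof -
  have mN: "f \<in> borel_measurable N \<longleftrightarrow> f \<in> borel_measurable borel" for f :: "real \<Rightarrow> 'b::topological_space"
    by (simp add: measurable_cong_sets[OF N refl])
  have e: "exp (- w * x - t * \<phi> w) = exp (- (t * \<phi> w)) * exp (- w * x)" for x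
    by (simp add: exp_add[symmetric])
  have [simp]: "sets Q = sets borel" by (simp add: Q_def N)
  then have [simp]: "space Q = UNIV" using sets_eq_imp_space_eq[of Q borel] by simp
  have int: "has_bochner_integral N (\<lambda>x. exp (- w * x - t * \<phi> w)) (exp (- (t * \<phi> w)) * exp (t * \<phi> w))"
    unfolding e using w by (intro has_bochner_integral_mult_right laplace) simp
  have "emeasure Q (space Q) = (\<integral>\<^sup>+x. ennreal (exp (- w * x - t * \<phi> w)) \<partial>N)"
    unfolding Q_def by (subst emeasure_density) (auto simp: mN intro!: nn_integral_cong)
  also have "\<dots> = ennreal (\<integral>x. exp (- w * x - t * \<phi> w) \<partial>N)"
    using int by (intro nn_integral_eq_integral) (auto simp: has_bochner_integral_iff)
  also have "(\<integral>x. exp (- w * x - t * \<phi> w) \<partial>N) = 1"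
    using has_bochner_integral_integral_eq[OF int] by (simp add: exp_minus)
  finally have "emeasure Q (space Q) = 1" by simp
  then interpret Q: prob_space Q by (rule prob_spaceI)
  show "real_distribution Q" by unfold_locales simp
  show "char Q = tilted_char \<phi> \<sigma> b \<nu> t w"
  proof
    fix \<xi> :: real
    let ?z = "of_real w - \<i> * of_real \<xi>"
    have "char Q \<xi> = (\<integral>x. exp (- w * x - t * \<phi> w) *\<^sub>R iexp (\<xi> * x) \<partial>N)"
      unfolding char_def Q_def by (subst integral_density) (simp_all add: mN)
    also have "\<dots> = (\<integral>x. exp (- of_real (t * \<phi> w)) * exp (- ?z * of_real x) \<partial>N)"
      by (intro Bochner_Integration.integral_cong refl)
        (simp add: scaleR_conv_of_real exp_of_real[symmetric] exp_add[symmetric] algebra_simps)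
    also have "\<dots> = exp (- of_real (t * \<phi> w)) * (\<integral>x. exp (- ?z * of_real x) \<partial>N)"
      by (rule integral_mult_right_zero)
    also have "\<dots> = tilted_char \<phi> \<sigma> b \<nu> t w \<xi>"
      using w by (subst laplace_transform_eq_complex_exponent)
        (simp_all add: tilted_char_def exp_add[symmetric] algebra_simps)
    finally show "char Q \<xi> = tilted_char \<phi> \<sigma> b \<nu> t w \<xi>" .
  qed
qed

text \<open>
  The tilt multiplies a density by a positive continuous function, which is undone after Fourier inversion.
\<close>

lemma density_of_integrable_tilted_char:
  assumes w: "0 < w" and int: "integrable lborel (tilted_char \<phi> \<sigma> b \<nu> t w)"
  defines "p \<equiv> \<lambda>x. exp (w * x + t * \<phi> w) * inverse_fourier (tilted_char \<phi> \<sigma> b \<nu> t w) x"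
  shows "continuous_on UNIV p" "\<And>x. 0 \<le> p x" "N = density lborel (\<lambda>x. ennreal (p x))"
proof -
  have mN: "f \<in> borel_measurable N \<longleftrightarrow> f \<in> borel_measurable borel" for f :: "real \<Rightarrow> 'b::topological_space"
    by (simp add: measurable_cong_sets[OF N refl])
  define Q where "Q = density N (\<lambda>x. ennreal (exp (- w * x - t * \<phi> w)))"
  have Q: "real_distribution Q" and char: "char Q = tilted_char \<phi> \<sigma> b \<nu> t w"
    unfolding Q_def by (rule exponentially_tilted_law[OF w])+
  have cont: "continuous_on UNIV (inverse_fourier (tilted_char \<phi> \<sigma> b \<nu> t w))"
    by (rule continuous_on_inverse_fourier[OF int])
  then show "continuous_on UNIV p"
    unfolding p_def by (intro continuous_intros)
  have nonneg: "0 \<le> inverse_fourier (tilted_char \<phi> \<sigma> b \<nu> t w) x" for x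
    using real_distribution.inverse_fourier_char_nonneg[OF Q] int by (simp add: char)
  then show "0 \<le> p x" for x by (simp add: p_def)
  have [measurable]: "inverse_fourier (tilted_char \<phi> \<sigma> b \<nu> t w) \<in> borel_measurable borel"
    by (rule borel_measurable_continuous_onI[OF cont])
  have "N = density N (\<lambda>x. 1)" by (simp add: density_1)
  also have "\<dots> = density Q (\<lambda>x. ennreal (exp (w * x + t * \<phi> w)))"
    unfolding Q_def
    by (subst density_density_eq) (simp_all add: mN ennreal_mult[symmetric] exp_add[symmetric])
  finally have N_Q: "N = density Q (\<lambda>x. ennreal (exp (w * x + t * \<phi> w)))" .
  have "Q = density lborel (\<lambda>x. ennreal (inverse_fourier (tilted_char \<phi> \<sigma> b \<nu> t w) x))"
    using real_distribution.density_inverse_fourier_char[OF Q] int by (simp add: char)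
  then show "N = density lborel (\<lambda>x. ennreal (p x))"
    unfolding N_Q by (simp add: density_density_eq ennreal_mult[symmetric] nonneg p_def mult.commute)
qed

end

lemma integrable_tilted_char:
  fixes \<phi> :: "real \<Rightarrow> real" and t w k A \<alpha> :: real
  assumes meas: "tilted_char \<phi> \<sigma> b \<nu> t w \<in> borel_measurable borel"
    and t: "0 < t" and w: "0 < w" and \<phi>'': "0 < deriv (deriv \<phi>) w"
    and k: "0 < k" and A: "0 \<le> A" and \<alpha>: "0 < \<alpha>" "\<alpha> \<le> 2"
    and decay: "\<And>\<xi>. k * (\<xi>\<^sup>2 * deriv (deriv \<phi>) w) * (1 + A * \<bar>\<xi>\<bar> / w) powr (\<alpha> - 2)
      \<le> \<phi> w - Re (complex_exponent \<sigma> b \<nu> (of_real w - \<i> * of_real \<xi>))"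
  shows "integrable lborel (tilted_char \<phi> \<sigma> b \<nu> t w)"
proof (rule Bochner_Integration.integrable_bound)
  let ?k = "k * t * deriv (deriv \<phi>) w"
  show "integrable lborel (\<lambda>\<xi>. exp (- (?k * \<xi>\<^sup>2 * (1 + A / w * \<bar>\<xi>\<bar>) powr (\<alpha> - 2))))"
    using assms by (intro integrable_stretched_gaussian) auto
  show "tilted_char \<phi> \<sigma> b \<nu> t w \<in> borel_measurable lborel" using meas by simp
  show "AE \<xi> in lborel. norm (tilted_char \<phi> \<sigma> b \<nu> t w \<xi>)
      \<le> norm (exp (- (?k * \<xi>\<^sup>2 * (1 + A / w * \<bar>\<xi>\<bar>) powr (\<alpha> - 2))))"
  proof (rule AE_I2)
    fix \<xi> :: real
    have "t * (k * (\<xi>\<^sup>2 * deriv (deriv \<phi>) w) * (1 + A * \<bar>\<xi>\<bar> / w) powr (\<alpha> - 2))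
        \<le> t * (\<phi> w - Re (complex_exponent \<sigma> b \<nu> (of_real w - \<i> * of_real \<xi>)))"
      using t by (intro mult_left_mono decay) simp
    moreover have "t * (k * (\<xi>\<^sup>2 * deriv (deriv \<phi>) w) * (1 + A * \<bar>\<xi>\<bar> / w) powr (\<alpha> - 2))
        = ?k * \<xi>\<^sup>2 * (1 + A / w * \<bar>\<xi>\<bar>) powr (\<alpha> - 2)"
      by (simp add: mult_ac)
    moreover have "t * (\<phi> w - r) = - (t * (r - \<phi> w))" for r by (simp add: algebra_simps)
    ultimately show "norm (tilted_char \<phi> \<sigma> b \<nu> t w \<xi>)
      \<le> norm (exp (- (?k * \<xi>\<^sup>2 * (1 + A / w * \<bar>\<xi>\<bar>) powr (\<alpha> - 2))))"
      unfolding tilted_char_def norm_exp_eq_Re by simp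
  qed
qed

text \<open>
  At \<open>x = - t \<phi>' w\<close> the exponential factor in the theorem cancels that of the tilt exactly. What is left is
  the Fourier integral in the variable \<open>u = s \<xi>\<close>, with the drift \<open>i \<xi> t \<phi>' w\<close> moved into the exponent.
\<close>

lemma saddle_point_rescaling:
  fixes \<phi> :: "real \<Rightarrow> real" and t w :: real
  assumes t: "0 < t" and \<phi>'': "0 < deriv (deriv \<phi>) w"
  defines "s \<equiv> sqrt (t * deriv (deriv \<phi>) w)"
    and "x \<equiv> - t * deriv \<phi> w"
  shows "exp (w * x + t * \<phi> w) * inverse_fourier (tilted_char \<phi> \<sigma> b \<nu> t w) x
      * sqrt (2 * pi * t * deriv (deriv \<phi>) w) * exp (t * (w * deriv \<phi> w - \<phi> w))
    = Re (\<integral>u. exp (of_real t * (complex_exponent \<sigma> b \<nu> (of_real w - \<i> * of_real (u / s)) - of_real (\<phi> w)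
        + \<i> * of_real (u / s) * of_real (deriv \<phi> w))) \<partial>lborel) / sqrt (2 * pi)"
proof -
  let ?E = "\<lambda>\<xi>. of_real t * (complex_exponent \<sigma> b \<nu> (of_real w - \<i> * of_real \<xi>) - of_real (\<phi> w)
        + \<i> * of_real \<xi> * of_real (deriv \<phi> w))"
  define I where "I = Re (\<integral>u. exp (?E (u / s)) \<partial>lborel)"
  have s: "0 < s" using t \<phi>'' by (simp add: s_def)
  have "(\<integral>\<xi>. iexp (- (\<xi> * x)) * tilted_char \<phi> \<sigma> b \<nu> t w \<xi> \<partial>lborel) = (\<integral>\<xi>. exp (?E \<xi>) \<partial>lborel)"
    by (intro Bochner_Integration.integral_cong refl)
      (simp add: tilted_char_def x_def exp_add[symmetric] algebra_simps)
  also have "\<dots> = \<bar>1 / s\<bar> *\<^sub>R (\<integral>u. exp (?E (0 + 1 / s * u)) \<partial>lborel)"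
    using s by (intro lborel_integral_real_affine) simp
  finally have "inverse_fourier (tilted_char \<phi> \<sigma> b \<nu> t w) x = 1 / s * I / (2 * pi)"
    using s by (simp add: inverse_fourier_def I_def)
  moreover have "sqrt (2 * pi * t * deriv (deriv \<phi>) w) = sqrt (2 * pi) * s"
    by (simp add: s_def real_sqrt_mult)
  moreover have "exp (w * x + t * \<phi> w) * exp (t * (w * deriv \<phi> w - \<phi> w)) = 1"
    by (simp add: exp_add[symmetric] x_def algebra_simps)
  moreover have "X * q * r * Y = (X * Y) * (q * r)" for X q r Y :: real
    by (simp only: mult_ac)
  ultimately have "exp (w * x + t * \<phi> w) * inverse_fourier (tilted_char \<phi> \<sigma> b \<nu> t w) x
      * sqrt (2 * pi * t * deriv (deriv \<phi>) w) * exp (t * (w * deriv \<phi> w - \<phi> w))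
      = (1 / s * I / (2 * pi)) * (sqrt (2 * pi) * s)"
    by (simp only: mult_1)
  also have "\<dots> = I * (sqrt (2 * pi) / (2 * pi))"
    using s by simp
  also have "sqrt (2 * pi) / (2 * pi) = 1 / sqrt (2 * pi)"
    by (subst sqrt_divide_self_eq) (simp_all add: inverse_eq_divide)
  finally show ?thesis by (simp add: I_def)
qed

section \<open>The saddle point approximation\<close>

theorem theorem3p1:
  fixes M :: "'a measure" and X :: "real \<Rightarrow> 'a \<Rightarrow> real"
    and \<phi> :: "real \<Rightarrow> real" and \<sigma> b :: real and \<nu> :: "real measure"
    and \<alpha> c x0 :: real
  assumes "spectrally_positive_levy_process M X"
    and "laplace_exponent M X \<phi>"
    and "levy_khintchine \<phi> \<sigma> b \<nu>"
    and "unbounded_variation \<sigma> \<nu>"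
    and "0 < c" and "c \<le> 1" and "0 \<le> x0" and "0 < \<alpha>"
    and "deriv (deriv \<phi>) \<in> WLSC (\<alpha> - 2) c x0"
  shows "(\<forall>t>0. absolutely_continuous lborel (distr M borel (X t))) \<and>
    (\<exists>p :: real \<Rightarrow> real \<Rightarrow> real.
       (\<forall>t>0. continuous_density M (X t) (p t)) \<and>
       (\<forall>\<epsilon>>0. \<exists>M0>0. \<forall>w>x0. \<forall>t>0. t * w\<^sup>2 * deriv (deriv \<phi>) w > M0 \<longrightarrow>
          \<bar>p t (- t * deriv \<phi> w) * sqrt (2 * pi * t * deriv (deriv \<phi>) w)
             * exp (t * (w * deriv \<phi> w - \<phi> w)) - 1\<bar> \<le> \<epsilon>))"
proof -
  let ?\<phi>'' = "deriv (deriv \<phi>)" and ?\<Phi> = "complex_exponent \<sigma> b \<nu>"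
  let ?\<chi> = "\<lambda>t w. tilted_char \<phi> \<sigma> b \<nu> t w"
  note LK = assms(3)
  have X: "X t \<in> borel_measurable M" if "0 < t" for t
    using assms(1) that by (simp add: spectrally_positive_levy_process_def levy_process_def)
  have laplace: "has_bochner_integral (distr M borel (X t)) (\<lambda>x. exp (- u * x)) (exp (t * \<phi> u))"
    if "0 < t" "0 \<le> u" for t u
    using assms(2) that X[OF that(1)] by (simp add: laplace_exponent_def has_bochner_integral_distr)
  define \<alpha>' where "\<alpha>' = min \<alpha> 2"
  have \<alpha>': "0 < \<alpha>'" "\<alpha>' \<le> 2" "\<alpha>' - 2 \<le> \<alpha> - 2" using assms(8) by (auto simp: \<alpha>'_def)
  have scaling: "?\<phi>'' \<in> WLSC (\<alpha>' - 2) c x0"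
    using assms(5,7) by (intro WLSC_antimono_exponent[OF assms(9) \<alpha>'(3)]) auto
  have pos: "0 < w" "0 < ?\<phi>'' w" if "x0 < w" for w
    using that assms(7) by (auto intro!: deriv_deriv_exponent_pos[OF LK assms(4)])
  obtain k A where k: "0 < k" and A: "0 \<le> A"
    and decay: "\<And>w \<xi>. x0 < w \<Longrightarrow> k * (\<xi>\<^sup>2 * ?\<phi>'' w) * (1 + A * \<bar>\<xi>\<bar> / w) powr (\<alpha>' - 2)
      \<le> \<phi> w - Re (?\<Phi> (of_real w - \<i> * of_real \<xi>))"
    using Re_complex_exponent_scaling_decay[OF LK scaling assms(5,7)] by metis
  obtain D where D: "0 < D" "\<And>w. x0 < w \<Longrightarrow> ?\<phi>'' (w / 2) \<le> D * ?\<phi>'' w"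
    using deriv_deriv_exponent_doubling[OF LK scaling assms(5,7,4)] by metis
  have meas: "?\<chi> t w \<in> borel_measurable borel" if "0 < t" "x0 < w" for t w
    using exponentially_tilted_law[OF LK _ laplace[OF that(1)] pos(1)[OF that(2)]]
      real_distribution.char_measurable by fastforce
  have int: "integrable lborel (?\<chi> t w)" if "0 < t" "x0 < w" for t w
    by (rule integrable_tilted_char[OF meas[OF that] that(1) pos[OF that(2)] k A \<alpha>'(1,2) decay[OF that(2)]])
  define q where "q = (\<lambda>w t x. exp (w * x + t * \<phi> w) * inverse_fourier (?\<chi> t w) x)"
  have distr: "distr M lborel (X t) = distr M borel (X t)" for t
    by (rule distr_cong) simp_all
  have q: "continuous_density M (X t) (q w t)" if "0 < t" "x0 < w" for t w
  proof -
    note * = density_of_integrable_tilted_char[OF LK _ laplace[OF that(1)] pos(1)[OF that(2)] int[OF that], simplified]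
    then show ?thesis
      using X[OF that(1)] borel_measurable_continuous_onI[OF *(1)]
      by (simp add: continuous_density_def distributed_def q_def distr)
  qed
  define p where "p = q (x0 + 1)"
  have p: "continuous_density M (X t) (p t)" if "0 < t" for t
    unfolding p_def using q[OF that] by simp
  have pq: "p t = q w t" if "0 < t" "x0 < w" for t w
    by (rule continuous_density_unique[OF p[OF that(1)] q[OF that]])
  have "absolutely_continuous lborel (distr M borel (X t))" if "0 < t" for t
  proof -
    have "distr M lborel (X t) = density lborel (\<lambda>x. ennreal (p t x))"
      "(\<lambda>x. ennreal (p t x)) \<in> borel_measurable lborel"
      using p[OF that] by (simp_all add: continuous_density_def distributed_def)
    then show ?thesis
      by (simp add: absolutely_continuousI_density distr)
  qed
  moreover have "\<exists>M0>0. \<forall>w>x0. \<forall>t>0. t * w\<^sup>2 * ?\<phi>'' w > M0 \<longrightarrow>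
      \<bar>p t (- t * deriv \<phi> w) * sqrt (2 * pi * t * ?\<phi>'' w) * exp (t * (w * deriv \<phi> w - \<phi> w)) - 1\<bar> \<le> \<epsilon>"
    if \<epsilon>: "0 < \<epsilon>" for \<epsilon>
  proof -
    have "0 \<le> D / 3" using D(1) by simp
    from integral_near_gaussian[OF k A \<alpha>'(1,2) this \<epsilon>] obtain M0 where M0: "0 < M0"
      and near: "\<And>T E. M0 < T \<Longrightarrow> (\<lambda>u. exp (E u)) \<in> borel_measurable borel \<Longrightarrow>
        (\<And>u. norm (E u + of_real (u\<^sup>2 / 2)) \<le> D / 3 * \<bar>u\<bar>^3 / sqrt T) \<Longrightarrow>
        (\<And>u. Re (E u) \<le> - (k * u\<^sup>2 * (1 + A * \<bar>u\<bar> / sqrt T) powr (\<alpha>' - 2))) \<Longrightarrow>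
        \<bar>Re (\<integral>u. exp (E u) \<partial>lborel) / sqrt (2 * pi) - 1\<bar> \<le> \<epsilon>"
      by metis
    have "\<bar>p t (- t * deriv \<phi> w) * sqrt (2 * pi * t * ?\<phi>'' w) * exp (t * (w * deriv \<phi> w - \<phi> w)) - 1\<bar> \<le> \<epsilon>"
      if w: "x0 < w" and t: "0 < t" and T: "M0 < t * w\<^sup>2 * ?\<phi>'' w" for w t
    proof -
      define s where "s = sqrt (t * ?\<phi>'' w)"
      have s: "0 < s" "s\<^sup>2 = t * ?\<phi>'' w" using t pos(2)[OF w] by (simp_all add: s_def)
      note w0 = pos(1)[OF w]
      have sqrtT: "sqrt (t * w\<^sup>2 * ?\<phi>'' w) = w * s"
        using w0 by (simp add: s_def real_sqrt_mult)
      define E where "E = (\<lambda>u. of_real t * (?\<Phi> (of_real w - \<i> * of_real (u / s)) - of_real (\<phi> w)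
        + \<i> * of_real (u / s) * of_real (deriv \<phi> w)))"
      have "p t (- t * deriv \<phi> w) * sqrt (2 * pi * t * ?\<phi>'' w) * exp (t * (w * deriv \<phi> w - \<phi> w))
          = Re (\<integral>u. exp (E u) \<partial>lborel) / sqrt (2 * pi)"
        unfolding pq[OF t w] q_def E_def s_def by (rule saddle_point_rescaling[OF t pos(2)[OF w]])
      moreover have "\<bar>Re (\<integral>u. exp (E u) \<partial>lborel) / sqrt (2 * pi) - 1\<bar> \<le> \<epsilon>"
      proof (rule near[OF T])
        have "exp (E u) = ?\<chi> t w (u / s) * iexp (t * deriv \<phi> w * (u / s))" for u
          by (simp add: E_def tilted_char_def exp_add[symmetric] algebra_simps)
        moreover have "(\<lambda>u. ?\<chi> t w (u / s) * iexp (t * deriv \<phi> w * (u / s))) \<in> borel_measurable borel"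
          using meas[OF t w] by measurable
        ultimately show "(\<lambda>u. exp (E u)) \<in> borel_measurable borel" by simp
      next
        fix u :: real
        have eq: "E u + of_real (u\<^sup>2 / 2) = of_real t * (?\<Phi> (of_real w - \<i> * of_real (u / s)) - of_real (\<phi> w)
            + \<i> * of_real (u / s) * of_real (deriv \<phi> w) + of_real ((u / s)\<^sup>2 * ?\<phi>'' w / 2))"
        proof -
          have "u\<^sup>2 / 2 = t * ((u / s)\<^sup>2 * ?\<phi>'' w / 2)"
            using s t pos(2)[OF w] by (simp add: power_divide)
          then show ?thesis
            unfolding E_def by (simp only: of_real_mult distrib_left)
        qed
        have "norm (E u + of_real (u\<^sup>2 / 2)) = t * norm (?\<Phi> (of_real w - \<i> * of_real (u / s)) - of_real (\<phi> w)
            + \<i> * of_real (u / s) * of_real (deriv \<phi> w) + of_real ((u / s)\<^sup>2 * ?\<phi>'' w / 2))"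
          unfolding eq norm_mult norm_of_real using t by simp
        also have "\<dots> \<le> t * (\<bar>u / s\<bar>^3 / (3 * w) * ?\<phi>'' (w / 2))"
          using t by (intro mult_left_mono complex_exponent_gaussian_approx[OF LK w0]) simp
        also have "\<dots> \<le> t * (\<bar>u / s\<bar>^3 / (3 * w) * (D * ?\<phi>'' w))"
          using t w0 by (intro mult_left_mono D(2) w) simp_all
        also have "\<dots> = D / 3 * \<bar>u / s\<bar>^3 / w * s\<^sup>2"
          using s(2) by simp
        also have "\<dots> = D / 3 * \<bar>u\<bar>^3 / (w * s)"
          using s(1) w0 by (simp add: power_divide abs_divide power2_eq_square power3_eq_cube mult_ac)
        finally show "norm (E u + of_real (u\<^sup>2 / 2)) \<le> D / 3 * \<bar>u\<bar>^3 / sqrt (t * w\<^sup>2 * ?\<phi>'' w)"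
          by (simp only: sqrtT)
      next
        fix u :: real
        have "Re (E u) = - (t * (\<phi> w - Re (?\<Phi> (of_real w - \<i> * of_real (u / s)))))"
          by (simp add: E_def algebra_simps)
        also have "\<dots> \<le> - (t * (k * ((u / s)\<^sup>2 * ?\<phi>'' w) * (1 + A * \<bar>u / s\<bar> / w) powr (\<alpha>' - 2)))"
          using t by (intro le_imp_neg_le mult_left_mono decay w) simp
        also have "\<dots> = - (k * u\<^sup>2 * (1 + A * \<bar>u\<bar> / (w * s)) powr (\<alpha>' - 2))"
        proof -
          have "t * ((u / s)\<^sup>2 * ?\<phi>'' w) = u\<^sup>2"
            using s t pos(2)[OF w] by (simp add: power_divide)
          moreover have "A * \<bar>u / s\<bar> / w = A * \<bar>u\<bar> / (w * s)"
            using s(1) by (simp add: abs_divide mult.commute)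
          moreover have "t * (k * Y * P) = k * (t * Y) * P" for Y P
            by (simp only: mult_ac)
          ultimately show ?thesis by (simp only:)
        qed
        finally show "Re (E u) \<le> - (k * u\<^sup>2 * (1 + A * \<bar>u\<bar> / sqrt (t * w\<^sup>2 * ?\<phi>'' w)) powr (\<alpha>' - 2))"
          by (simp only: sqrtT)
      qed
      ultimately show ?thesis by (simp only:)
    qed
    with M0 show ?thesis by blast
  qed
  ultimately show ?thesis
    using p by blast
qed

end
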